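(* (1) $\mathrm{P\text{-}Sel}\wedge\mathrm{P\text{-}Sel}\subseteq\mathrm{P\text{-}mc}(3)$, yet $\mathrm{P\text{-}Sel}\wedge\mathrm{P\text{-}Sel}\not\subseteq\mathrm{P\text{-}mc}(2)$. (2) $\mathrm{P\text{-}Sel}\vee\mathrm{P\text{-}Sel}\subseteq\mathrm{P\text{-}mc}(3)$, yet $\mathrm{P\text{-}Sel}\vee\mathrm{P\text{-}Sel}\not\subseteq\mathrm{P\text{-}mc}(2)$. (3) $\mathrm{P\text{-}Sel}\,\mathrm{XOR}\,\mathrm{P\text{-}Sel}\not\subseteq\mathrm{P\text{-}mc}(3)$ and $\mathrm{P\text{-}Sel}\,\mathrm{NXOR}\,\mathrm{P\text{-}Sel}\not\subseteq\mathrm{P\text{-}mc}(3)$.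
   Context: Sets are languages over $\Sigma=\{0,1\}$; FP is the class of polynomial-time computable functions; $\chi_A$ is the characteristic function of $A$; $\overline{A}=\Sigma^*-A$. A set $L$ is P-selective ($L\in\mathrm{P\text{-}Sel}$) if there is an FP function $f$ such that for all $x,y$, $f(x,y)\in\{x,y\}$ and if $x\in L$ or $y\in L$ then $f(x,y)\in L$. For classes $\mathcal{C},\mathcal{D}$: $\mathcal{C}\wedge\mathcal{D}=\{A\cap B:A\in\mathcal{C},B\in\mathcal{D}\}$, $\mathcal{C}\vee\mathcal{D}=\{A\cup B\}$, $\mathcal{C}\,\mathrm{XOR}\,\mathcal{D}=\{(A\cap\overline{B})\cup(\overline{A}\cap B)\}$, $\mathcal{C}\,\mathrm{NXOR}\,\mathcal{D}=\{(A\cap B)\cup(\overline{A}\cap\overline{B})\}$ (with $A\in\mathcal{C}$, $B\in\mathcal{D}$). For a positive integer $k$, $\mathrm{P\text{-}mc}(k)$ is the class of sets $A$ having a polynomial-time computable $f$ such that for all strings $z_1,\dots,z_m$ with $m\geq k$, $f(z_1,\dots,z_m)\in\{0,1\}^m$ and $(\chi_A(z_1),\dots,\chi_A(z_m))\neq f(z_1,\dots,z_m)$. *)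

theory Defs
  imports Main "HOL-Computational_Algebra.Polynomial"
begin

type_synonym word = "bool list"
type_synonym lang = "word set"

text \<open>
  Deterministic multitape Turing machines with two-way infinite tapes. States and tape symbols are
  initial segments of the natural numbers. State 0 is initial and state 1 is halting. Symbol 0 is
  the blank, symbols 1 and 2 stand for the letters 0 and 1 of the alphabet, and symbol 3 is the
  delimiter of the components of an input tuple. The first tape is the input tape, the second one
  is the output tape; every tape may be read and written.
\<close>

datatype move = Left | Stay | Right

record tm =
  num_tapes :: nat
  num_states :: nat
  num_symbols :: nat
  trans :: "nat \<Rightarrow> nat list \<Rightarrow> nat \<times> (nat \<times> move) list"

definition valid_tm :: "tm \<Rightarrow> bool" where
  "valid_tm M \<longleftrightarrow>
     2 \<le> num_tapes M \<and> 2 \<le> num_states M \<and> 4 \<le> num_symbols M \<and>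
     (\<forall>q xs q' acts. q < num_states M \<and> q \<noteq> 1 \<and>
        length xs = num_tapes M \<and> set xs \<subseteq> {..<num_symbols M} \<and> trans M q xs = (q', acts) \<longrightarrow>
        q' < num_states M \<and> length acts = num_tapes M \<and> fst ` set acts \<subseteq> {..<num_symbols M})"

text \<open>A tape consists of its contents and the position of its head.\<close>

type_synonym tape = "(int \<Rightarrow> nat) \<times> int"
type_synonym config = "nat \<times> tape list"

fun read_tape :: "tape \<Rightarrow> nat" where
  "read_tape (c, h) = c h"

fun offset :: "move \<Rightarrow> int" where
  "offset Left = -1"
| "offset Stay = 0"
| "offset Right = 1"

fun act :: "nat \<times> move \<Rightarrow> tape \<Rightarrow> tape" where
  "act (s, m) (c, h) = (c(h := s), h + offset m)"

fun step :: "tm \<Rightarrow> config \<Rightarrow> config" where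
  "step M (q, ts) =
     (if q = 1 then (q, ts)
      else case trans M q (map read_tape ts) of (q', acts) \<Rightarrow> (q', map2 act acts ts))"

definition written :: "nat list \<Rightarrow> int \<Rightarrow> nat" where
  "written xs i = (if 0 \<le> i \<and> i < int (length xs) then xs ! nat i else 0)"

definition letters :: "word \<Rightarrow> nat list" where
  "letters w = map (\<lambda>b. if b then 2 else 1) w"

definition encode_tuple :: "word list \<Rightarrow> nat list" where
  "encode_tuple zs = concat (map (\<lambda>z. letters z @ [3]) zs)"

definition init_config :: "tm \<Rightarrow> word list \<Rightarrow> config" where
  "init_config M zs =
     (0, (written (encode_tuple zs), 0) # replicate (num_tapes M - 1) (written [], 0))"

definition halts_with :: "config \<Rightarrow> word \<Rightarrow> bool" where
  "halts_with cfg w \<longleftrightarrow> fst cfg = 1 \<and> fst (snd cfg ! 1) = written (letters w)"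

text \<open>
  Functions of several (possibly variably many) strings are functions on lists; \<open>D\<close> is the set of
  admissible argument tuples, such as the pairs for a function of two arguments.
\<close>

definition poly_time_on :: "word list set \<Rightarrow> (word list \<Rightarrow> word) \<Rightarrow> bool" where
  "poly_time_on D f \<longleftrightarrow>
     (\<exists>M (p :: nat poly). valid_tm M \<and>
        (\<forall>zs\<in>D. \<exists>t \<le> poly p (length (encode_tuple zs)).
           halts_with ((step M ^^ t) (init_config M zs)) (f zs)))"

definition P_Sel :: "lang set" where
  "P_Sel = {L. \<exists>f. poly_time_on {zs. length zs = 2} f \<and>
     (\<forall>x y. f [x, y] \<in> {x, y} \<and> (x \<in> L \<or> y \<in> L \<longrightarrow> f [x, y] \<in> L))}"

text \<open>The list \<open>map (\<lambda>z. z \<in> A) zs\<close> is the vector of values of the characteristic function of \<open>A\<close>.\<close>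

definition P_mc :: "nat \<Rightarrow> lang set" where
  "P_mc k = {A. \<exists>f. poly_time_on UNIV f \<and>
     (\<forall>zs. k \<le> length zs \<longrightarrow> length (f zs) = length zs \<and> map (\<lambda>z. z \<in> A) zs \<noteq> f zs)}"

definition class_and :: "lang set \<Rightarrow> lang set \<Rightarrow> lang set" where
  "class_and C D = {A \<inter> B | A B. A \<in> C \<and> B \<in> D}"

definition class_or :: "lang set \<Rightarrow> lang set \<Rightarrow> lang set" where
  "class_or C D = {A \<union> B | A B. A \<in> C \<and> B \<in> D}"

definition class_xor :: "lang set \<Rightarrow> lang set \<Rightarrow> lang set" where
  "class_xor C D = {(A \<inter> - B) \<union> (- A \<inter> B) | A B. A \<in> C \<and> B \<in> D}"

definition class_nxor :: "lang set \<Rightarrow> lang set \<Rightarrow> lang set" where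
  "class_nxor C D = {(A \<inter> B) \<union> (- A \<inter> - B) | A B. A \<in> C \<and> B \<in> D}"

end

theory Submission
  imports Defs "HOL-Analysis.Finite_Cartesian_Product"
begin

text \<open>
  Upper bounds: among three words, at least two win a comparison by the selector of \<open>A\<close>, and one of
  these two, say \<open>r\<close>, wins their comparison by the selector of \<open>B\<close>. If the words other than \<open>r\<close> are all in
  \<open>A \<inter> B\<close>, then so is \<open>r\<close>, hence "exactly \<open>r\<close> is missing" is never the right answer. Unions are
  dual, with losers in place of winners. To make this a polynomial-time computation, programs of a
  small imperative language over tapes are compiled to Turing machines.

  Lower bounds: let two independent keys be stored in the even and the odd positions of a word. Every
  set of words whose first (second) key lies below a fixed cut is P-selective, with the same selector
  for all cuts. Two cuts can separate two words in all four ways for \<open>\<inter>\<close> and \<open>\<union>\<close>, and three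
  words in all eight ways for exclusive or and its negation, even if the cuts are only allowed to vary
  in an arbitrarily small interval. As there are only countably many polynomial-time functions,
  nested intervals yield two cuts that refute all of them.
\<close>

section \<open>Runs of machines\<close>

text \<open>The lower bounds need neither a universal machine nor a clock. P-selectivity bounds only
  the selector, so the cuts may come from an arbitrary, uncomputable sequence of words, and bare
  countability of the candidate functions is enough. Nested intervals become prefix extension:
  \<open>cut\<close> counts a comparison only if it is settled inside both words, and a settled
  comparison survives every further extension. Appended blocks have even length, so the two keys
  keep their parities.

  The upper bounds must call two unknown selector machines, which may leave arbitrary contents on
  their tapes and their heads anywhere. Hence every call gets its own fresh tapes, and only the
  output tape is recovered. Tape indices are constants of a program, so the winner of a comparison
  cannot be stored as an index; it is remembered by control flow, with one continuation per outcome.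

  Countability has an obstacle of its own: \<open>trans\<close> is a total function on all numbers
  and lists, so there are uncountably many machines. Only its finite table on legal arguments
  matters.\<close>

inductive reach :: "tm \<Rightarrow> nat \<Rightarrow> config \<Rightarrow> config \<Rightarrow> bool" for M where
  reach_refl: "reach M 0 c c"
| reach_step: "fst c \<noteq> 1 \<Longrightarrow> reach M n (step M c) c' \<Longrightarrow> reach M (Suc n) c c'"

lemma reach_trans: "reach M m c c' \<Longrightarrow> reach M n c' c'' \<Longrightarrow> reach M (m + n) c c''"
  by (induction rule: reach.induct) (auto intro: reach_step)

lemma reach_funpow: "reach M n c c' \<Longrightarrow> (step M ^^ n) c = c'"
  by (induction rule: reach.induct) (auto simp: funpow_swap1)

text \<open>The function \<open>step\<close> stutters in state 1, whereas \<open>reach\<close>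
  admits no step after halting; this is what allows the halting state to be renamed when machines
  are glued together. The run is cut at its first halting configuration.\<close>

lemma reach_halting:
  assumes "(step M ^^ t) c = (1, ts)"
  shows "\<exists>n\<le>t. reach M n c (1, ts)"
  using assms
proof (induction t arbitrary: c)
  case 0
  then show ?case by (auto intro: reach_refl)
next
  case (Suc t)
  show ?case
  proof (cases "fst c = 1")
    case True
    then obtain us where c: "c = (1, us)" by (cases c) auto
    have "(step M ^^ n) (1, us) = (1, us)" for n
      by (induction n) auto
    with Suc.prems c show ?thesis by (metis reach_refl le0)
  next
    case False
    have "(step M ^^ t) (step M c) = (1, ts)"
      using Suc.prems by (simp add: funpow_swap1)
    with Suc.IH obtain n where "n \<le> t" "reach M n (step M c) (1, ts)" by blast
    with False show ?thesis by (metis Suc_le_mono reach_step)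
  qed
qed

text \<open>Validity of a machine constrains its transitions only on legal states and symbols, so
  every simulation has to carry this invariant.\<close>

definition wf_config :: "tm \<Rightarrow> config \<Rightarrow> bool" where
  "wf_config M c \<longleftrightarrow> fst c < num_states M \<and> length (snd c) = num_tapes M \<and>
     (\<forall>t\<in>set (snd c). \<forall>i. fst t i < num_symbols M)"

lemma fst_act: "fst (act a t) = (fst t)(snd t := fst a)"
  by (cases a; cases t) simp

lemma snd_act: "snd (act a t) = snd t + offset (snd a)"
  by (cases a; cases t) simp

lemma read_tape_eq: "read_tape t = fst t (snd t)"
  by (cases t) simp

lemma valid_transD:
  assumes "valid_tm M" "wf_config M (q, ts)" "q \<noteq> 1" "trans M q (map read_tape ts) = (q', acts)"
  shows "q' < num_states M" "length acts = num_tapes M" "fst ` set acts \<subseteq> {..<num_symbols M}"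
proof -
  have "set (map read_tape ts) \<subseteq> {..<num_symbols M}"
    using assms(2) by (auto simp: wf_config_def read_tape_eq)
  with assms show "q' < num_states M" "length acts = num_tapes M"
      "fst ` set acts \<subseteq> {..<num_symbols M}"
    unfolding valid_tm_def wf_config_def by (metis fst_conv length_map snd_conv)+
qed

lemma wf_config_step:
  assumes "valid_tm M" "wf_config M c" "fst c \<noteq> 1"
  shows "wf_config M (step M c)"
proof -
  obtain q ts where c: "c = (q, ts)" by (cases c)
  obtain q' acts where tr: "trans M q (map read_tape ts) = (q', acts)" by fastforce
  note v = valid_transD[OF assms(1) _ _ tr]
  have *: "q' < num_states M" "length acts = num_tapes M" "fst ` set acts \<subseteq> {..<num_symbols M}"
    using v assms c by auto
  have "fst t i < num_symbols M" if "t \<in> set (map2 act acts ts)" for t i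
  proof -
    from that obtain a u where "a \<in> set acts" "u \<in> set ts" "t = act a u"
      by (fastforce dest: set_zip_leftD set_zip_rightD simp del: act.simps)
    with * assms(2) c show ?thesis by (auto simp: wf_config_def fst_act)
  qed
  with * tr c assms(2,3) show ?thesis by (auto simp: wf_config_def)
qed

lemma wf_config_reach: "reach M n c c' \<Longrightarrow> valid_tm M \<Longrightarrow> wf_config M c \<Longrightarrow> wf_config M c'"
  by (induction rule: reach.induct) (use wf_config_step in blast)+

text \<open>Here \<rho> renames states and \<phi> embeds the tapes. Only non-halting states must go
  to non-halting states: state 1 may be sent anywhere, which is how the end of one machine becomes
  the start of another.\<close>

lemma reach_simulate:
  assumes "reach M n c c'" "valid_tm M" "wf_config M c"
    and "\<And>q ts. wf_config M (q, ts) \<Longrightarrow> q \<noteq> 1 \<Longrightarrow>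
           \<rho> q \<noteq> 1 \<and> step N (\<rho> q, \<phi> ts) = map_prod \<rho> \<phi> (step M (q, ts))"
  shows "reach N n (map_prod \<rho> \<phi> c) (map_prod \<rho> \<phi> c')"
  using assms(1,3)
proof (induction rule: reach.induct)
  case (reach_refl c)
  show ?case by (rule reach.reach_refl)
next
  case (reach_step c n c')
  obtain q ts where c: "c = (q, ts)" by (cases c)
  have "wf_config M (step M c)" using reach_step assms(2) wf_config_step by blast
  with reach_step.IH have "reach N n (map_prod \<rho> \<phi> (step M c)) (map_prod \<rho> \<phi> c')" by blast
  moreover have "\<rho> q \<noteq> 1" "step N (\<rho> q, \<phi> ts) = map_prod \<rho> \<phi> (step M c)"
    using assms(4)[of q ts] reach_step.hyps(1) reach_step.prems c by auto
  ultimately show ?case using c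
    by (auto intro: reach.reach_step)
qed

text \<open>Ill-formed transitions are redirected to the halting state, which makes the machine valid.\<close>

definition mk_tm :: "nat \<Rightarrow> nat \<Rightarrow> nat \<Rightarrow> (nat \<Rightarrow> nat list \<Rightarrow> nat \<times> (nat \<times> move) list) \<Rightarrow> tm" where
  "mk_tm K n G \<delta> = \<lparr>num_tapes = K, num_states = n, num_symbols = G,
     trans = \<lambda>q xs. if fst (\<delta> q xs) < n \<and> length (snd (\<delta> q xs)) = K \<and> fst ` set (snd (\<delta> q xs)) \<subseteq> {..<G}
       then \<delta> q xs else (1, replicate K (0, Stay))\<rparr>"

lemma mk_tm_simps [simp]:
  "num_tapes (mk_tm K n G \<delta>) = K" "num_states (mk_tm K n G \<delta>) = n" "num_symbols (mk_tm K n G \<delta>) = G"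
  by (simp_all add: mk_tm_def)

lemma valid_mk_tm: "2 \<le> K \<Longrightarrow> 2 \<le> n \<Longrightarrow> 4 \<le> G \<Longrightarrow> valid_tm (mk_tm K n G \<delta>)"
  by (auto simp: valid_tm_def mk_tm_def image_subset_iff split: if_splits)

lemma step_mk_tm:
  assumes "q \<noteq> 1" "\<delta> q (map read_tape ts) = (q', acts)"
    "q' < n" "length acts = K" "fst ` set acts \<subseteq> {..<G}"
  shows "step (mk_tm K n G \<delta>) (q, ts) = (q', map2 act acts ts)"
  using assms by (auto simp: mk_tm_def)

section \<open>Composing machines: sequence, branching, loop and call\<close>

definition idle :: "nat list \<Rightarrow> (nat \<times> move) list" where
  "idle xs = map (\<lambda>s. (s, Stay)) xs"

lemma length_idle [simp]: "length (idle xs) = length xs"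
  by (simp add: idle_def)

lemma fst_set_idle [simp]: "fst ` set (idle xs) = set xs"
  by (simp add: idle_def image_image)

lemma act_read_Stay: "act (read_tape t, Stay) t = t"
  by (cases t) simp

lemma map2_act_idle [simp]: "map2 act (idle (map read_tape ts)) ts = ts"
  by (induction ts) (auto simp: idle_def act_read_Stay)

text \<open>Gluing costs no step: the end of \<open>M\<close> is redirected to state
  \<open>n\<close>, the shifted start of \<open>N\<close>, and the number 1 thereby becomes free for
  the halting state of the whole.\<close>

definition seq_tm :: "tm \<Rightarrow> tm \<Rightarrow> tm" where
  "seq_tm M N = (let n = num_states M in
     mk_tm (num_tapes M) (n + num_states N) (num_symbols M)
       (\<lambda>q xs. if q < n then apfst (\<lambda>q. if q = 1 then n else q) (trans M q xs)
               else apfst (\<lambda>q. if q = 1 then 1 else n + q) (trans N (q - n) xs)))"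

text \<open>States 0 and 1 are new here, so \<open>M\<close> is shifted by 2; state 0 performs the
  test on the scanned symbols, which is the one additional step.\<close>

definition if_tm :: "(nat list \<Rightarrow> bool) \<Rightarrow> tm \<Rightarrow> tm \<Rightarrow> tm" where
  "if_tm P M N = (let n = num_states M in
     mk_tm (num_tapes M) (2 + n + num_states N) (num_symbols M)
       (\<lambda>q xs. if q = 0 then (if P xs then 2 else 2 + n, idle xs)
               else if q < 2 + n then apfst (\<lambda>q. if q = 1 then 1 else 2 + q) (trans M (q - 2) xs)
               else apfst (\<lambda>q. if q = 1 then 1 else 2 + n + q) (trans N (q - (2 + n)) xs)))"

definition while_tm :: "(nat list \<Rightarrow> bool) \<Rightarrow> tm \<Rightarrow> tm" where
  "while_tm P M = mk_tm (num_tapes M) (2 + num_states M) (num_symbols M)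
     (\<lambda>q xs. if q = 0 then (if P xs then 2 else 1, idle xs)
             else apfst (\<lambda>q. if q = 1 then 0 else 2 + q) (trans M (q - 2) xs))"

definition call_tm :: "nat \<Rightarrow> nat \<Rightarrow> tm \<Rightarrow> nat \<Rightarrow> tm" where
  "call_tm K G M o' = (let k = num_tapes M in mk_tm K (num_states M) G
     (\<lambda>q xs. apsnd (\<lambda>acts. idle (take o' xs) @ acts @ idle (drop (o' + k) xs))
               (trans M q (take k (drop o' xs)))))"

text \<open>Common core of the simulations that leave the tapes unchanged: the transition is legal
  because \<open>M\<close> is valid, so the guard built into \<open>mk_tm\<close> lets it
  pass.\<close>

lemma step_transfer:
  assumes "valid_tm M" "wf_config M (q, ts)" "q \<noteq> 1" "q1 \<noteq> 1"
    and "num_symbols M = G" "num_tapes M = K"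
    and "\<delta> q1 (map read_tape ts) = apfst \<rho> (trans M q (map read_tape ts))"
    and "\<And>q. q < num_states M \<Longrightarrow> \<rho> q < n"
  shows "step (mk_tm K n G \<delta>) (q1, ts) = map_prod \<rho> id (step M (q, ts))"
proof -
  obtain q' acts where tr: "trans M q (map read_tape ts) = (q', acts)" by fastforce
  note v = valid_transD[OF assms(1,2,3) tr]
  have "step (mk_tm K n G \<delta>) (q1, ts) = (\<rho> q', map2 act acts ts)"
    by (rule step_mk_tm) (use assms tr v in auto)
  then show ?thesis using tr assms(3) by simp
qed

lemma reach_seq_tm:
  assumes "valid_tm M" "valid_tm N" "num_tapes N = num_tapes M" "num_symbols N = num_symbols M"
    and "wf_config M (0, ts)" "reach M m (0, ts) (1, ts')" "reach N n (0, ts') (1, ts'')"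
  shows "reach (seq_tm M N) (m + n) (0, ts) (1, ts'')"
proof -
  have st: "2 \<le> num_states M" "2 \<le> num_states N" using assms(1,2) by (auto simp: valid_tm_def)
  have wf: "wf_config N (0, ts')"
    using wf_config_reach[OF assms(6,1,5)] assms(3,4) st by (auto simp: wf_config_def)
  have "reach (seq_tm M N) m (map_prod (\<lambda>q. if q = 1 then num_states M else q) id (0, ts))
      (map_prod (\<lambda>q. if q = 1 then num_states M else q) id (1, ts'))"
    by (rule reach_simulate[OF assms(6,1,5)])
       (use st assms(1) in \<open>auto simp: seq_tm_def Let_def wf_config_def simp del: step.simps intro!: step_transfer\<close>)
  moreover have "reach (seq_tm M N) n (map_prod (\<lambda>q. if q = 1 then 1 else num_states M + q) id (0, ts'))
      (map_prod (\<lambda>q. if q = 1 then 1 else num_states M + q) id (1, ts''))"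
    by (rule reach_simulate[OF assms(7,2) wf])
       (use st assms(2,3,4) in \<open>auto simp: seq_tm_def Let_def wf_config_def simp del: step.simps intro!: step_transfer\<close>)
  ultimately show ?thesis using reach_trans by fastforce
qed

lemma step_if_tm:
  assumes "valid_tm M" "valid_tm N" "wf_config M (0, ts)"
  shows "step (if_tm P M N) (0, ts) = (if P (map read_tape ts) then 2 else 2 + num_states M, ts)"
  unfolding if_tm_def Let_def
  by (subst step_mk_tm[where acts = "idle (map read_tape ts)"])
     (use assms in \<open>auto simp: wf_config_def valid_tm_def read_tape_eq\<close>)

lemma reach_if_tm_True:
  assumes "valid_tm M" "valid_tm N"
    and "wf_config M (0, ts)" "reach M m (0, ts) (1, ts')" "P (map read_tape ts)"
  shows "reach (if_tm P M N) (Suc m) (0, ts) (1, ts')"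
proof -
  have st: "2 \<le> num_states M" "2 \<le> num_states N" using assms(1,2) by (auto simp: valid_tm_def)
  have "reach (if_tm P M N) m (map_prod (\<lambda>q. if q = 1 then 1 else 2 + q) id (0, ts))
      (map_prod (\<lambda>q. if q = 1 then 1 else 2 + q) id (1, ts'))"
    by (rule reach_simulate[OF assms(4,1,3)])
       (use st assms(1) in \<open>auto simp: if_tm_def Let_def wf_config_def simp del: step.simps intro!: step_transfer\<close>)
  then show ?thesis
    using step_if_tm[OF assms(1-3), of P] assms(5) by (auto intro!: reach_step simp del: step.simps)
qed

lemma reach_if_tm_False:
  assumes "valid_tm M" "valid_tm N" "num_tapes N = num_tapes M" "num_symbols N = num_symbols M"
    and "wf_config M (0, ts)" "reach N m (0, ts) (1, ts')" "\<not> P (map read_tape ts)"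
  shows "reach (if_tm P M N) (Suc m) (0, ts) (1, ts')"
proof -
  have st: "2 \<le> num_states M" "2 \<le> num_states N" using assms(1,2) by (auto simp: valid_tm_def)
  have wf: "wf_config N (0, ts)"
    using assms(3,4,5) st by (auto simp: wf_config_def)
  have "reach (if_tm P M N) m (map_prod (\<lambda>q. if q = 1 then 1 else 2 + num_states M + q) id (0, ts))
      (map_prod (\<lambda>q. if q = 1 then 1 else 2 + num_states M + q) id (1, ts'))"
    by (rule reach_simulate[OF assms(6,2) wf])
       (use st assms(2-4) in \<open>auto simp: if_tm_def Let_def wf_config_def simp del: step.simps intro!: step_transfer\<close>)
  then show ?thesis
    using step_if_tm[OF assms(1,2,5), of P] assms(7) by (auto intro!: reach_step simp del: step.simps)
qed

lemma step_while_tm: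
  assumes "valid_tm M" "wf_config M (0, ts)"
  shows "step (while_tm P M) (0, ts) = (if P (map read_tape ts) then 2 else 1, ts)"
  unfolding while_tm_def
  by (subst step_mk_tm[where acts = "idle (map read_tape ts)"])
     (use assms in \<open>auto simp: wf_config_def valid_tm_def read_tape_eq\<close>)

lemma reach_while_tm_False:
  assumes "valid_tm M" "wf_config M (0, ts)" "\<not> P (map read_tape ts)"
  shows "reach (while_tm P M) 1 (0, ts) (1, ts)"
  using reach_step[OF _ reach_refl, of "(0, ts)" "while_tm P M"] step_while_tm[OF assms(1,2), of P] assms(3)
  by simp

lemma reach_while_tm_True:
  assumes "valid_tm M"
    and "wf_config M (0, ts)" "reach M m (0, ts) (1, ts')" "P (map read_tape ts)"
    and "reach (while_tm P M) n (0, ts') c"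
  shows "reach (while_tm P M) (Suc (m + n)) (0, ts) c"
proof -
  have st: "2 \<le> num_states M" using assms(1) by (auto simp: valid_tm_def)
  have "reach (while_tm P M) m (map_prod (\<lambda>q. if q = 1 then 0 else 2 + q) id (0, ts))
      (map_prod (\<lambda>q. if q = 1 then 0 else 2 + q) id (1, ts'))"
    by (rule reach_simulate[OF assms(3,1,2)])
       (use st assms(1) in \<open>auto simp: while_tm_def wf_config_def simp del: step.simps intro!: step_transfer\<close>)
  then have "reach (while_tm P M) (m + n) (2, ts) c"
    using assms(5) reach_trans by fastforce
  then show ?thesis
    using step_while_tm[OF assms(1,2), of P] assms(4) by (auto intro!: reach_step simp del: step.simps)
qed

lemma reach_call_tm:
  assumes "valid_tm M" "wf_config M (0, ts)" "reach M m (0, ts) (1, ts')"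
    and "num_symbols M \<le> G" "length us + num_tapes M + length vs = K"
    and "\<forall>t\<in>set us \<union> set vs. \<forall>i. fst t i < G"
  shows "reach (call_tm K G M (length us)) m (0, us @ ts @ vs) (1, us @ ts' @ vs)"
proof -
  have "reach (call_tm K G M (length us)) m (map_prod id (\<lambda>ts. us @ ts @ vs) (0, ts))
      (map_prod id (\<lambda>ts. us @ ts @ vs) (1, ts'))"
  proof (rule reach_simulate[OF assms(3,1,2)])
    fix q ts assume wf: "wf_config M (q, ts)" and q: "q \<noteq> 1"
    obtain q' acts where tr: "trans M q (map read_tape ts) = (q', acts)" by fastforce
    note v = valid_transD[OF assms(1) wf q tr]
    have len: "length ts = num_tapes M" using wf by (simp add: wf_config_def)
    have sym: "fst ` set (idle (map read_tape us) @ acts @ idle (map read_tape vs)) \<subseteq> {..<G}"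
      using v(3) assms(4,6) by (fastforce simp: idle_def read_tape_eq)
    have "step (call_tm K G M (length us)) (q, us @ ts @ vs) =
        (q', map2 act (idle (map read_tape us) @ acts @ idle (map read_tape vs)) (us @ ts @ vs))"
      unfolding call_tm_def Let_def
      by (rule step_mk_tm) (use q tr v assms(4,5) len sym in auto)
    also have "\<dots> = map_prod id (\<lambda>ts. us @ ts @ vs) (step M (q, ts))"
      using tr q v len by simp
    finally show "id q \<noteq> 1 \<and> step (call_tm K G M (length us)) (id q, us @ ts @ vs) =
        map_prod id (\<lambda>ts. us @ ts @ vs) (step M (q, ts))"
      using q by simp
  qed
  then show ?thesis by simp
qed

section \<open>A small imperative language for tapes\<close>

type_synonym store = "nat \<Rightarrow> tape"

abbreviation reads :: "store \<Rightarrow> nat \<Rightarrow> nat" where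
  "reads ts \<equiv> \<lambda>j. read_tape (ts j)"

datatype prog =
  Put nat "(nat \<Rightarrow> nat) \<Rightarrow> nat" move
| Seq prog prog (infixr \<open>;;\<close> 60)
| Cond "(nat \<Rightarrow> nat) \<Rightarrow> bool" prog prog
| While "(nat \<Rightarrow> nat) \<Rightarrow> bool" prog
| Call tm nat

definition block :: "store \<Rightarrow> nat \<Rightarrow> nat \<Rightarrow> tape list" where
  "block ts i n = map ts [i..<i + n]"

text \<open>
  The number in \<open>exec p ts n ts'\<close> is an upper bound on the running time. A call runs a machine on
  the consecutive tapes that start at a given index.
\<close>

inductive exec :: "prog \<Rightarrow> store \<Rightarrow> nat \<Rightarrow> store \<Rightarrow> bool" where
  exec_Put: "exec (Put i f m) ts 1 (ts(i := act (f (reads ts), m) (ts i)))"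
| exec_Seq: "exec p ts m us \<Longrightarrow> exec q us n vs \<Longrightarrow> exec (p ;; q) ts (m + n) vs"
| exec_Cond: "exec (if P (reads ts) then p else q) ts n us \<Longrightarrow> exec (Cond P p q) ts (Suc n) us"
| exec_While_False: "\<not> P (reads ts) \<Longrightarrow> exec (While P p) ts 1 ts"
| exec_While_True: "P (reads ts) \<Longrightarrow> exec p ts m us \<Longrightarrow> exec (While P p) us n vs \<Longrightarrow>
    exec (While P p) ts (Suc (m + n)) vs"
| exec_Call: "wf_config M (0, block ts i (num_tapes M)) \<Longrightarrow>
    reach M n (0, block ts i (num_tapes M)) (1, us) \<Longrightarrow>
    exec (Call M i) ts n (\<lambda>j. if i \<le> j \<and> j < i + num_tapes M then us ! (j - i) else ts j)"
| exec_weaken: "exec p ts m us \<Longrightarrow> m \<le> n \<Longrightarrow> exec p ts n us"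

fun wf_prog :: "nat \<Rightarrow> nat \<Rightarrow> prog \<Rightarrow> bool" where
  "wf_prog K G (Put i f m) \<longleftrightarrow> i < K \<and> (\<forall>r. (\<forall>j. r j < G) \<longrightarrow> f r < G)"
| "wf_prog K G (p ;; q) \<longleftrightarrow> wf_prog K G p \<and> wf_prog K G q"
| "wf_prog K G (Cond P p q) \<longleftrightarrow> wf_prog K G p \<and> wf_prog K G q"
| "wf_prog K G (While P p) \<longleftrightarrow> wf_prog K G p"
| "wf_prog K G (Call M i) \<longleftrightarrow> valid_tm M \<and> i + num_tapes M \<le> K \<and> num_symbols M \<le> G"

text \<open>Programs see infinitely many tapes, a machine only \<open>K\<close> of them. The default
  0 is the blank that \<open>wf_store\<close> imposes on all tapes from \<open>K\<close> on.\<close>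

definition symbol_at :: "nat list \<Rightarrow> nat \<Rightarrow> nat" where
  "symbol_at xs j = (if j < length xs then xs ! j else 0)"

primrec compile :: "nat \<Rightarrow> nat \<Rightarrow> prog \<Rightarrow> tm" where
  "compile K G (Put i f m) = mk_tm K 2 G (\<lambda>q xs. (1, (idle xs)[i := (f (symbol_at xs), m)]))"
| "compile K G (p ;; q) = seq_tm (compile K G p) (compile K G q)"
| "compile K G (Cond P p q) = if_tm (\<lambda>xs. P (symbol_at xs)) (compile K G p) (compile K G q)"
| "compile K G (While P p) = while_tm (\<lambda>xs. P (symbol_at xs)) (compile K G p)"
| "compile K G (Call M i) = call_tm K G M i"

lemma compile_simps [simp]:
  "num_tapes (compile K G p) = K" "num_symbols (compile K G p) = G"
  by (induction p) (auto simp: seq_tm_def if_tm_def while_tm_def call_tm_def Let_def)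

lemma valid_compile:
  assumes "2 \<le> K" "4 \<le> G" "wf_prog K G p"
  shows "valid_tm (compile K G p)"
  using assms(3)
proof (induction p)
  case (Call M i)
  then have "2 \<le> num_states M" by (simp add: valid_tm_def)
  then show ?case using assms by (auto simp: call_tm_def Let_def intro!: valid_mk_tm)
next
  case (Seq p q)
  then show ?case using assms
    by (auto simp: seq_tm_def Let_def intro!: valid_mk_tm) (simp add: valid_tm_def)
qed (use assms in \<open>auto simp: seq_tm_def if_tm_def while_tm_def Let_def intro!: valid_mk_tm\<close>)

definition wf_store :: "nat \<Rightarrow> nat \<Rightarrow> store \<Rightarrow> bool" where
  "wf_store K G ts \<longleftrightarrow> (\<forall>j i. fst (ts j) i < G) \<and> (\<forall>j\<ge>K. fst (ts j) = (\<lambda>_. 0))"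

lemma symbol_at_reads:
  "wf_store K G ts \<Longrightarrow> symbol_at (map read_tape (block ts 0 K)) = reads ts"
  by (auto simp: symbol_at_def block_def wf_store_def read_tape_eq fun_eq_iff)

lemma wf_config_compile:
  assumes "2 \<le> K" "4 \<le> G" "wf_prog K G p" "wf_store K G ts"
  shows "wf_config (compile K G p) (0, block ts 0 K)"
  using valid_compile[OF assms(1-3)] assms(4)
  by (auto simp: wf_config_def block_def wf_store_def valid_tm_def)

text \<open>Induction on the execution. \<open>wf_store\<close> is carried along because the
  compiled machine follows the program only while all symbols are below \<open>G\<close> and the
  tapes beyond \<open>K\<close> are blank. The machine may be faster than \<open>n\<close>, since
  \<open>exec\<close> bounds the time only from above.\<close>

theorem exec_compile:
  assumes "2 \<le> K" "4 \<le> G"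
  shows "exec p ts n us \<Longrightarrow> wf_prog K G p \<Longrightarrow> wf_store K G ts \<Longrightarrow>
    wf_store K G us \<and> (\<exists>m\<le>n. reach (compile K G p) m (0, block ts 0 K) (1, block us 0 K))"
proof (induction rule: exec.induct)
  case (exec_Put i f m ts)
  let ?M = "compile K G (Put i f m)" and ?us = "ts(i := act (f (reads ts), m) (ts i))"
  have i: "i < K" and f: "f (reads ts) < G"
    using exec_Put by (auto simp: wf_store_def read_tape_eq)
  have "step ?M (0, block ts 0 K) =
      (1, map2 act ((idle (map read_tape (block ts 0 K)))[i := (f (reads ts), m)]) (block ts 0 K))"
    unfolding compile.simps
  proof (rule step_mk_tm)
    have "set (map read_tape (block ts 0 K)) \<subseteq> {..<G}"
      using exec_Put.prems(2) by (auto simp: wf_store_def block_def read_tape_eq)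
    then show "fst ` set ((idle (map read_tape (block ts 0 K)))[i := (f (reads ts), m)]) \<subseteq> {..<G}"
      using f set_update_subset_insert[of "idle (map read_tape (block ts 0 K))" i "(f (reads ts), m)"]
      by (fastforce simp: idle_def)
  qed (simp_all add: symbol_at_reads[OF exec_Put.prems(2)], simp add: block_def)
  also have "map2 act ((idle (map read_tape (block ts 0 K)))[i := (f (reads ts), m)]) (block ts 0 K)
      = block ?us 0 K"
    by (rule nth_equalityI) (auto simp: block_def idle_def nth_list_update act_read_Stay)
  finally have "reach ?M 1 (0, block ts 0 K) (1, block ?us 0 K)"
    using reach_step[OF _ reach_refl, of "(0, block ts 0 K)" ?M] by simp
  moreover have "wf_store K G ?us"
    using exec_Put.prems(2) i f by (auto simp: wf_store_def fst_act)
  ultimately show ?case by blast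
next
  case (exec_Seq p ts m us q n vs)
  then obtain m' n' where *: "m' \<le> m" "n' \<le> n" "wf_store K G us" "wf_store K G vs"
      "reach (compile K G p) m' (0, block ts 0 K) (1, block us 0 K)"
      "reach (compile K G q) n' (0, block us 0 K) (1, block vs 0 K)"
    by auto
  have "reach (compile K G (p ;; q)) (m' + n') (0, block ts 0 K) (1, block vs 0 K)"
    unfolding compile.simps
    by (rule reach_seq_tm[OF _ _ _ _ _ *(5,6)])
       (use assms exec_Seq.prems in \<open>auto intro!: valid_compile wf_config_compile\<close>)
  with * show ?case by (meson add_le_mono)
next
  case (exec_Cond P ts p q n us)
  have wf: "wf_prog K G p" "wf_prog K G q" using exec_Cond.prems by auto
  then have "wf_prog K G (if P (reads ts) then p else q)" by simp
  with exec_Cond obtain m where *: "m \<le> n" "wf_store K G us"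
      "reach (compile K G (if P (reads ts) then p else q)) m (0, block ts 0 K) (1, block us 0 K)"
    by blast
  have v: "valid_tm (compile K G p)" "valid_tm (compile K G q)"
      "wf_config (compile K G p) (0, block ts 0 K)"
    using assms wf exec_Cond.prems by (auto intro!: valid_compile wf_config_compile)
  have "reach (compile K G (Cond P p q)) (Suc m) (0, block ts 0 K) (1, block us 0 K)"
  proof (cases "P (reads ts)")
    case True
    then show ?thesis unfolding compile.simps
      by (intro reach_if_tm_True[OF v]) (use * symbol_at_reads[OF exec_Cond.prems(2)] in auto)
  next
    case False
    then show ?thesis unfolding compile.simps
      by (intro reach_if_tm_False[OF v(1,2) _ _ v(3)])
         (use * symbol_at_reads[OF exec_Cond.prems(2)] in auto)
  qed
  with * show ?case by (meson Suc_le_mono)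
next
  case (exec_While_False P ts p)
  have "reach (compile K G (While P p)) 1 (0, block ts 0 K) (1, block ts 0 K)"
    unfolding compile.simps
    by (rule reach_while_tm_False)
       (use assms exec_While_False symbol_at_reads[OF exec_While_False.prems(2)]
        in \<open>auto intro!: valid_compile wf_config_compile\<close>)
  with exec_While_False show ?case by blast
next
  case (exec_While_True P ts p m us n vs)
  then obtain m' n' where *: "m' \<le> m" "n' \<le> n" "wf_store K G us" "wf_store K G vs"
      "reach (compile K G p) m' (0, block ts 0 K) (1, block us 0 K)"
      "reach (compile K G (While P p)) n' (0, block us 0 K) (1, block vs 0 K)"
    by (auto simp del: compile.simps)
  have "reach (compile K G (While P p)) (Suc (m' + n')) (0, block ts 0 K) (1, block vs 0 K)"
    unfolding compile.simps
    by (rule reach_while_tm_True[OF _ _ *(5) _ *(6)[unfolded compile.simps]])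
       (use assms exec_While_True symbol_at_reads[OF exec_While_True.prems(2)]
        in \<open>auto intro!: valid_compile wf_config_compile\<close>)
  moreover have "Suc (m' + n') \<le> Suc (m + n)" using * by simp
  ultimately show ?case using * by blast
next
  case (exec_Call M ts i n us)
  let ?k = "num_tapes M" and ?us = "\<lambda>j. if i \<le> j \<and> j < i + num_tapes M then us ! (j - i) else ts j"
  have M: "valid_tm M" "i + ?k \<le> K" "num_symbols M \<le> G" using exec_Call by auto
  have wf: "wf_config M (1, us)"
    using wf_config_reach[OF exec_Call.hyps(2) M(1) exec_Call.hyps(1)] .
  then have len: "length us = ?k" by (simp add: wf_config_def)
  have split: "block ts 0 K = block ts 0 i @ block ts i ?k @ block ts (i + ?k) (K - (i + ?k))"
    by (rule nth_equalityI) (use M(2) in \<open>auto simp: block_def nth_append\<close>)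
  have "reach (call_tm K G M (length (block ts 0 i))) n
      (0, block ts 0 i @ block ts i ?k @ block ts (i + ?k) (K - (i + ?k)))
      (1, block ts 0 i @ us @ block ts (i + ?k) (K - (i + ?k)))"
    by (rule reach_call_tm[OF M(1) exec_Call.hyps])
       (use M exec_Call.prems(2) in \<open>auto simp: block_def wf_store_def\<close>)
  moreover have "block ts 0 i @ us @ block ts (i + ?k) (K - (i + ?k)) = block ?us 0 K"
    by (rule nth_equalityI) (use len M(2) in \<open>auto simp: block_def nth_append\<close>)
  ultimately have "reach (compile K G (Call M i)) n (0, block ts 0 K) (1, block ?us 0 K)"
    using split by (simp add: block_def)
  moreover have "fst (us ! k) i < G" if "k < ?k" for k i
  proof -
    have "us ! k \<in> set us" using that len by simp
    then show ?thesis using wf M(3) unfolding wf_config_def by (metis less_le_trans snd_conv)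
  qed
  then have "wf_store K G ?us"
    using exec_Call.prems(2) M by (auto simp: wf_store_def)
  ultimately show ?case by blast
next
  case (exec_weaken p ts m us n)
  then show ?case by (meson le_trans)
qed

section \<open>Programs as a source of polynomial-time functions\<close>

definition input_store :: "word list \<Rightarrow> store" where
  "input_store zs = (\<lambda>_. (written [], 0))(0 := (written (encode_tuple zs), 0))"

lemma written_Nil: "written [] = (\<lambda>_. 0)"
  by (simp add: written_def fun_eq_iff)

lemma set_encode_tuple: "set (encode_tuple zs) \<subseteq> {1, 2, 3}"
  by (auto simp: encode_tuple_def letters_def)

lemma written_less: "set xs \<subseteq> {..<G} \<Longrightarrow> 0 < G \<Longrightarrow> written xs i < G"
  by (auto simp: written_def subset_iff)

theorem poly_time_onI:
  fixes P :: "nat poly"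
  assumes "2 \<le> K" "4 \<le> G" "wf_prog K G p"
    and "\<And>zs. zs \<in> D \<Longrightarrow> \<exists>us. exec p (input_store zs) (poly P (length (encode_tuple zs))) us \<and>
           fst (us 1) = written (letters (f zs))"
  shows "poly_time_on D f"
  unfolding poly_time_on_def
proof (rule exI[of _ "compile K G p"], rule exI[of _ P], intro conjI ballI)
  show "valid_tm (compile K G p)" using assms by (intro valid_compile)
  fix zs assume "zs \<in> D"
  with assms(4) obtain us where us: "exec p (input_store zs) (poly P (length (encode_tuple zs))) us"
    "fst (us 1) = written (letters (f zs))" by blast
  have "wf_store K G (input_store zs)"
    using assms(1,2) set_encode_tuple[of zs]
    by (auto simp: wf_store_def input_store_def written_Nil intro!: written_less)
  from exec_compile[OF assms(1,2) us(1) assms(3) this] obtain m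
    where m: "m \<le> poly P (length (encode_tuple zs))"
      "reach (compile K G p) m (0, block (input_store zs) 0 K) (1, block us 0 K)" by blast
  have "init_config (compile K G p) zs = (0, block (input_store zs) 0 K)"
    unfolding init_config_def
    by (auto simp: block_def input_store_def nth_Cons split: nat.splits intro!: nth_equalityI)
       (use assms(1) in auto)
  with reach_funpow[OF m(2)] m(1) us(2) assms(1)
  show "\<exists>t\<le>poly P (length (encode_tuple zs)).
      halts_with ((step (compile K G p) ^^ t) (init_config (compile K G p) zs)) (f zs)"
    by (auto simp: halts_with_def block_def intro!: exI[of _ m])
qed

section \<open>Loops and elementary tape programs\<close>

lemma exec_cong: "exec p ts m us \<Longrightarrow> us = vs \<Longrightarrow> m \<le> n \<Longrightarrow> exec p ts n vs"
  using exec_weaken by blast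

text \<open>\<open>S k\<close> is the store after \<open>k\<close> rounds; giving it in closed form
  takes the place of a loop invariant. \<open>Suc b\<close> is the cost of the body and one
  test.\<close>

lemma exec_While_iterate:
  assumes "\<And>k. k < n \<Longrightarrow> P (reads (S k)) \<and> exec p (S k) b (S (Suc k))" and "\<not> P (reads (S n))"
  shows "exec (While P p) (S 0) (n * Suc b + 1) (S n)"
  using assms
proof (induction n arbitrary: S)
  case 0
  then show ?case by (simp add: exec_While_False flip: One_nat_def)
next
  case (Suc n)
  have "exec (While P p) (S (Suc 0)) (n * Suc b + 1) (S (Suc n))"
    using Suc.IH[of "\<lambda>k. S (Suc k)"] Suc.prems by simp
  then have "exec (While P p) (S 0) (Suc (b + (n * Suc b + 1))) (S (Suc n))"
    using Suc.prems(1)[of 0] by (intro exec_While_True) auto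
  then show ?case by (simp add: algebra_simps)
qed

definition Move :: "nat \<Rightarrow> move \<Rightarrow> prog" where
  "Move i m = Put i (\<lambda>r. r i) m"

definition Copy :: "nat \<Rightarrow> nat \<Rightarrow> (nat \<Rightarrow> bool) \<Rightarrow> prog" where
  "Copy i j stop = While (\<lambda>r. \<not> stop (r i)) (Put j (\<lambda>r. r i) Right ;; Move i Right)"

text \<open>Tapes are two-way infinite, so the blank just left of cell 0 serves as the stopper. The
  move before the loop is there because the head may rest on the blank behind the word, where the
  loop would stop at once.\<close>

definition Rewind :: "nat \<Rightarrow> prog" where
  "Rewind i = Move i Left ;; While (\<lambda>r. r i \<noteq> 0) (Move i Left) ;; Move i Right"

lemma wf_Move [simp]: "wf_prog K G (Move i m) \<longleftrightarrow> i < K"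
  by (auto simp: Move_def)

lemma wf_Copy [simp]: "wf_prog K G (Copy i j stop) \<longleftrightarrow> i < K \<and> j < K"
  by (auto simp: Copy_def)

lemma wf_Rewind [simp]: "wf_prog K G (Rewind i) \<longleftrightarrow> i < K"
  by (auto simp: Rewind_def)

lemma exec_Move: "exec (Move i m) ts 1 (ts(i := (fst (ts i), snd (ts i) + offset m)))"
  using exec_Put[of i "\<lambda>r. r i" m ts] by (cases "ts i") (simp add: Move_def)

lemma exec_Put_eq:
  "exec (Put i f m) ts 1 (ts(i := ((fst (ts i))(snd (ts i) := f (reads ts)), snd (ts i) + offset m)))"
  using exec_Put[of i f m ts] by (cases "ts i") simp

lemma exec_scan:
  assumes "ts i = (c, h)" "\<And>k. k < n \<Longrightarrow> P (c (h + int k * offset m))" "\<not> P (c (h + int n * offset m))"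
  shows "exec (While (\<lambda>r. P (r i)) (Move i m)) ts (2 * n + 1) (ts(i := (c, h + int n * offset m)))"
proof -
  let ?S = "\<lambda>k. ts(i := (c, h + int k * offset m))"
  have "exec (While (\<lambda>r. P (r i)) (Move i m)) (?S 0) (n * Suc 1 + 1) (?S n)"
  proof (rule exec_While_iterate)
    fix k assume "k < n"
    have "exec (Move i m) (?S k) 1 (?S (Suc k))"
      by (rule exec_cong[OF exec_Move]) (auto simp: algebra_simps)
    then show "P (reads (?S k) i) \<and> exec (Move i m) (?S k) 1 (?S (Suc k))"
      using assms(2)[OF \<open>k < n\<close>] by simp
  qed (use assms(3) in simp)
  moreover have "?S 0 = ts" using assms(1) by (simp add: fun_upd_idem)
  ultimately have "exec (While (\<lambda>r. P (r i)) (Move i m)) ts (n * Suc 1 + 1) (?S n)" by simp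
  then show ?thesis by (rule exec_weaken) simp
qed

lemma written_snoc: "(written ys)(int (length ys) := s) = written (ys @ [s])"
  by (auto simp: written_def fun_eq_iff nth_append)

lemma written_cell: "(written [])(0 := s) = written [s]" "(written [a])(0 := s) = written [s]"
  by (auto simp: written_def fun_eq_iff)

lemma written_nth: "written xs (int k) = (if k < length xs then xs ! k else 0)"
  by (simp add: written_def)

lemma written_neg: "h < 0 \<Longrightarrow> written xs h = 0"
  by (simp add: written_def)

lemma exec_Copy:
  assumes "ts i = (c, h)" "ts j = (written ys, int (length ys))" "i \<noteq> j"
    and "\<And>k. k < length xs \<Longrightarrow> c (h + int k) = xs ! k \<and> \<not> stop (xs ! k)"
    and "stop (c (h + int (length xs)))"
  shows "exec (Copy i j stop) ts (3 * length xs + 1)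
    (ts(i := (c, h + int (length xs)), j := (written (ys @ xs), int (length ys + length xs))))"
proof -
  let ?S = "\<lambda>k. ts(i := (c, h + int k), j := (written (ys @ take k xs), int (length ys + k)))"
  have "exec (Copy i j stop) (?S 0) (length xs * Suc (1 + 1) + 1) (?S (length xs))"
    unfolding Copy_def
  proof (rule exec_While_iterate, intro conjI)
    fix k assume k: "k < length xs"
    show "\<not> stop (reads (?S k) i)" using assms(3,4) k by simp
    have *: "(written (ys @ take k xs))(int (length ys + k) := xs ! k) = written (ys @ take (Suc k) xs)"
      using written_snoc[of "ys @ take k xs" "xs ! k"] k by (simp add: take_Suc_conv_app_nth)
    show "exec (Put j (\<lambda>r. r i) Right ;; Move i Right) (?S k) (1 + 1) (?S (Suc k))"
      by (rule exec_cong[OF exec_Seq[OF exec_Put_eq exec_Move]])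
         (use assms(3,4) k in \<open>auto simp: *[simplified] intro!: ext\<close>)
  qed (use assms(3,5) in simp)
  moreover have "?S 0 = ts" using assms by (auto simp: fun_eq_iff)
  ultimately have "exec (Copy i j stop) ts (length xs * Suc (1 + 1) + 1) (?S (length xs))" by simp
  then show ?thesis by (rule exec_cong) auto
qed

lemma exec_Rewind:
  assumes "ts i = (written xs, int k)" "k \<le> length xs" "0 \<notin> set xs"
  shows "exec (Rewind i) ts (2 * k + 3) (ts(i := (written xs, 0)))"
proof -
  let ?t = "ts(i := (written xs, int k - 1))"
  have 1: "exec (Move i Left) ts 1 ?t"
    by (rule exec_cong[OF exec_Move]) (use assms(1) in auto)
  have 2: "exec (While (\<lambda>r. r i \<noteq> 0) (Move i Left)) ?t (2 * k + 1) (?t(i := (written xs, int k - 1 + int k * offset Left)))"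
  proof (rule exec_scan)
    fix l assume "l < k"
    then have "int k - 1 + int l * offset Left = int (k - 1 - l)" by auto
    then show "written xs (int k - 1 + int l * offset Left) \<noteq> 0"
      using assms(2,3) \<open>l < k\<close> by (auto simp: written_nth in_set_conv_nth simp del: of_nat_diff)
  qed (auto simp: written_neg)
  have 3: "exec (Move i Right) (?t(i := (written xs, int k - 1 + int k * offset Left))) 1 (ts(i := (written xs, 0)))"
    by (rule exec_cong[OF exec_Move]) auto
  show ?thesis unfolding Rewind_def
    by (rule exec_cong[OF exec_Seq[OF 1 exec_Seq[OF 2 3]]]) auto
qed

lemma length_letters [simp]: "length (letters w) = length w"
  by (simp add: letters_def)

lemma nth_letters: "k < length w \<Longrightarrow> letters w ! k = (if w ! k then 2 else 1)"
  by (simp add: letters_def)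

lemma zero_notin_letters [simp]: "0 \<notin> set (letters w)" "3 \<notin> set (letters w)"
  by (auto simp: letters_def)

lemma encode_tuple_simps [simp]:
  "encode_tuple [] = []" "encode_tuple (z # zs) = letters z @ 3 # encode_tuple zs"
  by (simp_all add: encode_tuple_def)

section \<open>Selecting the smaller of two words\<close>

text \<open>Only the positions of one parity are compared, so a word carries two independent keys.\<close>

definition first_diff :: "bool \<Rightarrow> word \<Rightarrow> word \<Rightarrow> nat" where
  "first_diff p x y = (LEAST k. length x \<le> k \<or> length y \<le> k \<or> (even k = p \<and> x ! k \<noteq> y ! k))"

lemma first_diff_at:
  "length x \<le> first_diff p x y \<or> length y \<le> first_diff p x y \<or>
   (even (first_diff p x y) = p \<and> x ! first_diff p x y \<noteq> y ! first_diff p x y)"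
  unfolding first_diff_def
  by (rule LeastI[of "\<lambda>k. length x \<le> k \<or> length y \<le> k \<or> (even k = p \<and> x ! k \<noteq> y ! k)" "length x"]) simp

lemma first_diff_below:
  assumes "k < first_diff p x y"
  shows "k < length x" "k < length y" "even k = p \<Longrightarrow> x ! k = y ! k"
  using not_less_Least[OF assms[unfolded first_diff_def]] by auto

lemma first_diff_le: "first_diff p x y \<le> length x" "first_diff p x y \<le> length y"
  unfolding first_diff_def by (rule Least_le; simp)+

text \<open>If one word runs out first, the longer one is picked, since extending a word cannot
  remove it from a cut. Otherwise the words differ at \<open>n\<close>, and the one with letter 0 is
  the smaller.\<close>

definition picks_first :: "bool \<Rightarrow> word \<Rightarrow> word \<Rightarrow> bool" where
  "picks_first p x y \<longleftrightarrow> (let n = first_diff p x y in n < length x \<and> (n = length y \<or> \<not> x ! n))"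

definition sel :: "bool \<Rightarrow> word list \<Rightarrow> word" where
  "sel p zs = (if picks_first p (zs ! 0) (zs ! 1) then zs ! 0 else zs ! 1)"

text \<open>Strict lexicographic order of the keys, except that the difference must occur within
  both words: a prefix is not below its extensions. Membership is therefore stable under extending
  either word.\<close>

definition cut :: "bool \<Rightarrow> word \<Rightarrow> word set" where
  "cut p w = {z. \<exists>d. d < length z \<and> d < length w \<and> even d = p \<and> \<not> z ! d \<and> w ! d \<and>
     (\<forall>e<d. even e = p \<longrightarrow> z ! e = w ! e)}"

lemma sel_cut:
  assumes "x \<in> cut p w \<or> y \<in> cut p w"
  shows "sel p [x, y] \<in> cut p w"
proof -
  let ?n = "first_diff p x y"
  note at = first_diff_at[of x p y] and below = first_diff_below[of _ p x y]
    and le = first_diff_le[of p x y]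
  have transfer: "v \<in> cut p w"
    if uv: "u \<in> cut p w" and len: "?n \<le> length u" "?n \<le> length v"
      and eq: "\<And>k. k < ?n \<Longrightarrow> even k = p \<Longrightarrow> u ! k = v ! k"
      and end': "?n = length u \<or> (?n < length v \<and> even ?n = p \<and> u ! ?n \<and> \<not> v ! ?n)" for u v
  proof -
    from uv obtain d where d: "d < length u" "d < length w" "even d = p" "\<not> u ! d" "w ! d"
      "\<forall>e<d. even e = p \<longrightarrow> u ! e = w ! e" by (auto simp: cut_def)
    \<comment> \<open>If \<open>d\<close> lies before \<open>?n\<close>, it also settles
      \<open>v\<close> against \<open>w\<close>. Otherwise \<open>?n\<close> does: there
      \<open>w\<close> still agrees with \<open>u\<close> and has 1, while \<open>v\<close> has
      0.\<close>
    show ?thesis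
    proof (cases "d < ?n")
      case True
      then show ?thesis using d eq len unfolding cut_def by (auto intro!: exI[of _ d])
    next
      case False
      then have *: "?n < length v" "even ?n = p" "u ! ?n" "\<not> v ! ?n" using end' d by auto
      then have "d \<noteq> ?n" using d by auto
      with False have "?n < d" by simp
      then show ?thesis using * d eq unfolding cut_def by (auto intro!: exI[of _ ?n])
    qed
  qed
  show ?thesis
  proof (cases "picks_first p x y")
    case True
    then have "x \<in> cut p w"
      using assms transfer[of y x] at below le by (auto simp: picks_first_def Let_def)
    with True show ?thesis by (simp add: sel_def)
  next
    case False
    then have "y \<in> cut p w"
      using assms transfer[of x y] at below le by (auto simp: picks_first_def Let_def)
    with False show ?thesis by (simp add: sel_def)
  qed
qed

text \<open>Tape 2 holds a copy of the first word, tape 3 a flag that is 1 at the positions of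
  parity \<open>p\<close>. The loop stops exactly at \<open>first_diff\<close>; a blank on tape 2 or
  the delimiter on tape 0 shows the end of a word, and symbol 1 is the letter 0. The first word is
  output from its copy, the second from the input tape.\<close>

definition Sel :: "bool \<Rightarrow> prog" where
  "Sel p = Copy 0 2 (\<lambda>s. s = 3) ;; Move 0 Right ;; Rewind 2 ;; Put 3 (\<lambda>_. of_bool p) Stay ;;
     While (\<lambda>r. r 0 \<noteq> 3 \<and> r 2 \<noteq> 0 \<and> (r 3 = 1 \<longrightarrow> r 0 = r 2))
       (Move 0 Right ;; Move 2 Right ;; Put 3 (\<lambda>r. 1 - r 3) Stay) ;;
     Cond (\<lambda>r. r 2 \<noteq> 0 \<and> (r 0 = 3 \<or> r 2 = 1))
       (Rewind 2 ;; Copy 2 1 (\<lambda>s. s = 0))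
       (Move 0 Left ;; While (\<lambda>r. r 0 \<noteq> 3) (Move 0 Left) ;; Move 0 Right ;; Copy 0 1 (\<lambda>s. s = 3))"

definition four :: "tape \<Rightarrow> tape \<Rightarrow> tape \<Rightarrow> tape \<Rightarrow> store" where
  "four a b c d = (\<lambda>_. (written [], 0))(0 := a, 1 := b, 2 := c, 3 := d)"

lemma four_simps [simp]:
  "four a b c d 0 = a" "four a b c d (Suc 0) = b" "four a b c d 2 = c" "four a b c d 3 = d"
  by (simp_all add: four_def)

lemma four_upd [simp]:
  "(four a b c d)(0 := e) = four e b c d" "(four a b c d)(Suc 0 := e) = four a e c d"
  "(four a b c d)(2 := e) = four a b e d" "(four a b c d)(3 := e) = four a b c e"
  by (auto simp: four_def fun_eq_iff)

lemma exec_Sel: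
  "\<exists>us. exec (Sel p) (input_store [x, y]) (20 * (length x + length y) + 20) us \<and>
     fst (us 1) = written (letters (sel p [x, y]))"
proof -
  define c where "c = written (encode_tuple [x, y])"
  define n where "n = first_diff p x y"
  let ?B = "(written [], 0)" and ?X = "written (letters x)" and ?P = "\<lambda>k. written [of_bool (even k = p)]"
  note below = first_diff_below[of _ p x y, folded n_def] and at = first_diff_at[of x p y, folded n_def]
    and le = first_diff_le[of p x y, folded n_def]
  have cx: "c (int k) = letters x ! k" if "k < length x" for k
    using that by (simp add: c_def written_nth nth_append)
  have c3: "c (int (length x)) = 3"
    by (simp add: c_def written_nth nth_append)
  have cy: "c (int (length x) + 1 + int k) = letters y ! k" if "k < length y" for k
  proof -
    have "c (int (length x + 1 + k)) = letters y ! k"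
      using that unfolding c_def written_nth by (simp add: nth_append)
    then show ?thesis by (simp add: algebra_simps)
  qed
  have cy3: "c (int (length x) + 1 + int (length y)) = 3"
  proof -
    have "c (int (length x + 1 + length y)) = 3"
      unfolding c_def written_nth by (simp add: nth_append)
    then show ?thesis by (simp add: algebra_simps)
  qed
  have 0: "input_store [x, y] = four (c, 0) ?B ?B ?B"
    by (auto simp: input_store_def four_def c_def fun_eq_iff)
  have 1: "exec (Copy 0 2 (\<lambda>s. s = 3)) (four (c, 0) ?B ?B ?B) (3 * length x + 1)
      (four (c, int (length x)) ?B (?X, int (length x)) ?B)"
    by (rule exec_cong[OF exec_Copy[where xs = "letters x" and ys = "[]" and c = c and h = 0]])
       (use cx c3 in \<open>auto simp: nth_letters\<close>)
  have 2: "exec (Move 0 Right) (four (c, int (length x)) ?B (?X, int (length x)) ?B) 1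
      (four (c, int (length x) + 1) ?B (?X, int (length x)) ?B)"
    by (rule exec_cong[OF exec_Move]) auto
  have 3: "exec (Rewind 2) (four (c, int (length x) + 1) ?B (?X, int (length x)) ?B) (2 * length x + 3)
      (four (c, int (length x) + 1) ?B (?X, 0) ?B)"
    by (rule exec_cong[OF exec_Rewind[where xs = "letters x" and k = "length x"]]) auto
  have 4: "exec (Put 3 (\<lambda>_. of_bool p) Stay) (four (c, int (length x) + 1) ?B (?X, 0) ?B) 1
      (four (c, int (length x) + 1) ?B (?X, 0) (?P 0, 0))"
    by (rule exec_cong[OF exec_Put_eq]) (auto simp: written_cell)
  let ?S = "\<lambda>k. four (c, int (length x) + 1 + int k) ?B (?X, int k) (?P k, 0)"
  have 5: "exec (While (\<lambda>r. r 0 \<noteq> 3 \<and> r 2 \<noteq> 0 \<and> (r 3 = 1 \<longrightarrow> r 0 = r 2))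
       (Move 0 Right ;; Move 2 Right ;; Put 3 (\<lambda>r. 1 - r 3) Stay)) (?S 0) (n * Suc (1 + (1 + 1)) + 1) (?S n)"
  proof (rule exec_While_iterate[of _ _ ?S], intro conjI)
    fix k assume k: "k < n"
    show "reads (?S k) 0 \<noteq> 3" "reads (?S k) 2 \<noteq> 0" "reads (?S k) 3 = 1 \<longrightarrow> reads (?S k) 0 = reads (?S k) 2"
      using below[OF k] by (auto simp: cy written_nth nth_letters) (auto simp: written_def split: if_splits)
    show "exec (Move 0 Right ;; Move 2 Right ;; Put 3 (\<lambda>r. 1 - r 3) Stay) (?S k) (1 + (1 + 1)) (?S (Suc k))"
      by (rule exec_cong[OF exec_Seq[OF exec_Move exec_Seq[OF exec_Move exec_Put_eq]]])
         (auto simp: algebra_simps written_cell, auto simp: written_def)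
  next
    show "\<not> (reads (?S n) 0 \<noteq> 3 \<and> reads (?S n) 2 \<noteq> 0 \<and> (reads (?S n) 3 = 1 \<longrightarrow> reads (?S n) 0 = reads (?S n) 2))"
    proof (cases "n = length x \<or> n = length y")
      case True
      then show ?thesis using cy3 by (auto simp: written_nth)
    next
      case False
      with at le have "n < length x" "n < length y" "even n = p" "x ! n \<noteq> y ! n" by auto
      then show ?thesis using cy[of n] by (auto simp: written_nth nth_letters) (simp_all add: written_def)
    qed
  qed
  have test: "reads (?S n) 2 \<noteq> 0 \<and> (reads (?S n) 0 = 3 \<or> reads (?S n) 2 = 1) \<longleftrightarrow> picks_first p x y"
    using at le cy[of n] cy3
    by (cases "n = length x"; cases "n = length y")
       (auto simp: picks_first_def Let_def n_def[symmetric] written_nth nth_letters)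
  have "\<exists>us. exec (if reads (?S n) 2 \<noteq> 0 \<and> (reads (?S n) 0 = 3 \<or> reads (?S n) 2 = 1)
       then Rewind 2 ;; Copy 2 1 (\<lambda>s. s = 0)
       else Move 0 Left ;; While (\<lambda>r. r 0 \<noteq> 3) (Move 0 Left) ;; Move 0 Right ;; Copy 0 1 (\<lambda>s. s = 3))
     (?S n) (5 * (length x + length y) + 5) us \<and> fst (us 1) = written (letters (sel p [x, y]))"
  proof (cases "picks_first p x y")
    case True
    have a: "exec (Rewind 2) (?S n) (2 * n + 3) (four (c, int (length x) + 1 + int n) ?B (?X, 0) (?P n, 0))"
      by (rule exec_cong[OF exec_Rewind[where xs = "letters x" and k = n]]) (use le in auto)
    have b: "exec (Copy 2 1 (\<lambda>s. s = 0)) (four (c, int (length x) + 1 + int n) ?B (?X, 0) (?P n, 0))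
        (3 * length x + 1) (four (c, int (length x) + 1 + int n) (?X, int (length x)) (?X, int (length x)) (?P n, 0))"
      by (rule exec_cong[OF exec_Copy[where xs = "letters x" and ys = "[]" and c = ?X and h = 0]])
         (auto simp: nth_letters written_nth)
    show ?thesis
      unfolding test if_P[OF True]
      by (rule exI, rule conjI, rule exec_weaken[OF exec_Seq[OF a b]])
         (use le True in \<open>auto simp: sel_def\<close>)
  next
    case False
    let ?T = "\<lambda>h. four (c, h) ?B (?X, int n) (?P n, 0)"
    have a: "exec (Move 0 Left) (?S n) 1 (?T (int (length x) + int n))"
      by (rule exec_cong[OF exec_Move]) auto
    have b: "exec (While (\<lambda>r. r 0 \<noteq> 3) (Move 0 Left)) (?T (int (length x) + int n)) (2 * n + 1)
        (?T (int (length x)))"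
    proof (rule exec_cong[OF exec_scan[where c = c and h = "int (length x) + int n" and n = n]])
      fix k assume "k < n"
      then have *: "int (length x) + int n + int k * offset Left = int (length x) + 1 + int (n - 1 - k)"
        by auto
      show "c (int (length x) + int n + int k * offset Left) \<noteq> 3"
        unfolding * using \<open>k < n\<close> le by (subst cy) (auto simp: nth_letters)
    qed (use c3 in auto)
    have d: "exec (Move 0 Right) (?T (int (length x))) 1 (?T (int (length x) + 1))"
      by (rule exec_cong[OF exec_Move]) auto
    have e: "exec (Copy 0 1 (\<lambda>s. s = 3)) (?T (int (length x) + 1)) (3 * length y + 1)
        (four (c, int (length x) + 1 + int (length y)) (written (letters y), int (length y)) (?X, int n) (?P n, 0))"
      by (rule exec_cong[OF exec_Copy[where xs = "letters y" and ys = "[]" and c = c and h = "int (length x) + 1"]])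
         (use cy cy3 in \<open>auto simp: nth_letters\<close>)
    show ?thesis
      unfolding test if_not_P[OF False]
      by (rule exI, rule conjI, rule exec_weaken[OF exec_Seq[OF a exec_Seq[OF b exec_Seq[OF d e]]]])
         (use le False in \<open>auto simp: sel_def\<close>)
  qed
  then obtain us where us: "exec (if reads (?S n) 2 \<noteq> 0 \<and> (reads (?S n) 0 = 3 \<or> reads (?S n) 2 = 1)
       then Rewind 2 ;; Copy 2 1 (\<lambda>s. s = 0)
       else Move 0 Left ;; While (\<lambda>r. r 0 \<noteq> 3) (Move 0 Left) ;; Move 0 Right ;; Copy 0 1 (\<lambda>s. s = 3))
     (?S n) (5 * (length x + length y) + 5) us" "fst (us 1) = written (letters (sel p [x, y]))" by blast
  note 6 = exec_Cond[where P = "\<lambda>r. r 2 \<noteq> 0 \<and> (r 0 = 3 \<or> r 2 = 1)", OF us(1)]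
  have 40: "exec (Put 3 (\<lambda>_. of_bool p) Stay) (four (c, int (length x) + 1) ?B (?X, 0) ?B) 1 (?S 0)"
    using 4 by simp
  have "exec (Sel p) (input_store [x, y]) (20 * (length x + length y) + 20) us"
    unfolding Sel_def 0
    by (rule exec_weaken[OF exec_Seq[OF 1 exec_Seq[OF 2 exec_Seq[OF 3 exec_Seq[OF 40 exec_Seq[OF 5 6]]]]]])
       (use le in auto)
  with us(2) show ?thesis by blast
qed

lemma poly_time_sel: "poly_time_on {zs. length zs = 2} (sel p)"
proof (rule poly_time_onI[where K = 4 and G = 4 and P = "[:20, 20:]" and p = "Sel p"])
  show "wf_prog 4 4 (Sel p)" by (auto simp: Sel_def intro: le_less_trans[OF diff_le_self])
  fix zs :: "word list" assume "zs \<in> {zs. length zs = 2}"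
  then obtain x y where zs: "zs = [x, y]" by (auto simp: numeral_2_eq_2 length_Suc_conv)
  show "\<exists>us. exec (Sel p) (input_store zs) (poly [:20, 20:] (length (encode_tuple zs))) us \<and>
      fst (us 1) = written (letters (sel p zs))"
    using exec_Sel[of p x y] unfolding zs by (force intro: exec_weaken)
qed auto

text \<open>The selector does not depend on \<open>w\<close>: it keeps each single cut closed and
  hence their union. So the sequence \<open>w\<close> may be entirely arbitrary, which is the
  freedom that diagonalisation exploits.\<close>

lemma Union_cut_P_Sel: "(\<Union>i. cut p (w i)) \<in> P_Sel"
proof -
  have "sel p [x, y] \<in> {x, y}" for x y by (simp add: sel_def)
  moreover have "sel p [x, y] \<in> (\<Union>i. cut p (w i))"
    if "x \<in> (\<Union>i. cut p (w i)) \<or> y \<in> (\<Union>i. cut p (w i))" for x y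
    using that sel_cut by blast
  ultimately show ?thesis using poly_time_sel unfolding P_Sel_def by blast
qed

section \<open>There are only countably many polynomial-time functions\<close>

instance move :: countable
  by countable_datatype

lemma halting_stable: "fst ((step M ^^ t) c) = 1 \<Longrightarrow> (step M ^^ (d + t)) c = (step M ^^ t) c"
proof (induction d)
  case (Suc d)
  then show ?case by (cases "(step M ^^ t) c") simp
qed simp

text \<open>Without blanks inside, the first blank on the tape reveals the length of the
  word.\<close>

lemma written_inj:
  assumes "0 \<notin> set xs" "0 \<notin> set ys" "written xs = written ys"
  shows "xs = ys"
proof -
  have *: "length us \<ge> length vs" if "0 \<notin> set vs" "written us = written vs" for us vs
  proof (rule ccontr)
    assume "\<not> length us \<ge> length vs"
    then have "vs ! length us \<in> set vs" "written us (int (length us)) = 0"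
      "written vs (int (length us)) = vs ! length us"
      by (auto simp: written_nth)
    with that show False by auto
  qed
  then have "length xs = length ys" using assms by (metis order_antisym)
  moreover have "xs ! k = ys ! k" if "k < length xs" for k
    using fun_cong[OF assms(3), of "int k"] that calculation by (simp add: written_nth)
  ultimately show ?thesis by (rule nth_equalityI)
qed

lemma letters_inj: "letters v = letters w \<Longrightarrow> v = w"
  by (auto simp: letters_def intro!: map_injective[of _ v w] injI split: if_splits)

lemma halts_with_unique:
  assumes "halts_with ((step M ^^ s) c) v" "halts_with ((step M ^^ t) c) w"
  shows "v = w"
proof -
  have "(step M ^^ s) c = (step M ^^ t) c"
    using halting_stable[of s M c t] halting_stable[of t M c s] assms
    by (auto simp: halts_with_def add.commute)
  then have "written (letters v) = written (letters w)" using assms by (auto simp: halts_with_def)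
  then show ?thesis by (intro letters_inj written_inj) auto
qed

definition outcome :: "tm \<Rightarrow> word list \<Rightarrow> word" where
  "outcome M zs = (THE w. \<exists>t. halts_with ((step M ^^ t) (init_config M zs)) w)"

definition keys :: "nat \<Rightarrow> nat \<Rightarrow> nat \<Rightarrow> (nat \<times> nat list) set" where
  "keys K n G = {..<n} \<times> {xs. set xs \<subseteq> {..<G} \<and> length xs = K}"

definition table_tm :: "nat \<Rightarrow> nat \<Rightarrow> nat \<Rightarrow> (nat \<times> nat list \<Rightarrow> nat \<times> (nat \<times> move) list) \<Rightarrow> tm" where
  "table_tm K n G g = \<lparr>num_tapes = K, num_states = n, num_symbols = G, trans = \<lambda>q xs. g (q, xs)\<rparr>"

text \<open>Restriction to the finite set \<open>keys\<close> discards the values of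
  \<open>trans\<close> on illegal arguments. What remains lies in a product of countable sets over a
  finite index set.\<close>

definition table :: "tm \<Rightarrow> nat \<times> nat list \<Rightarrow> nat \<times> (nat \<times> move) list" where
  "table M = restrict (\<lambda>(q, xs). trans M q xs) (keys (num_tapes M) (num_states M) (num_symbols M))"

definition table_tms :: "tm set" where
  "table_tms = (\<Union>K n G. table_tm K n G ` (keys K n G \<rightarrow>\<^sub>E UNIV))"

lemma countable_table_tms: "countable table_tms"
  unfolding table_tms_def keys_def
  by (intro countable_UN countable_image countable_PiE finite_cartesian_product finite_lists_length_eq)
     auto

lemma wf_config_init: "valid_tm M \<Longrightarrow> wf_config M (init_config M zs)"
  using set_encode_tuple[of zs]
  by (auto simp: wf_config_def init_config_def valid_tm_def intro!: written_less)

text \<open>Well-formed configurations are preserved and consult only arguments in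
  \<open>keys\<close>, so both machines make the same run; uniqueness of the halting output turns
  this into an equation.\<close>

lemma outcome_table_tm:
  assumes "valid_tm M" "halts_with ((step M ^^ t) (init_config M zs)) w"
  defines "N \<equiv> table_tm (num_tapes M) (num_states M) (num_symbols M) (table M)"
  shows "outcome N zs = w"
proof -
  have step_eq: "step N c = step M c" if "wf_config M c" for c
  proof (cases c)
    case (Pair q ts)
    have "(q, map read_tape ts) \<in> keys (num_tapes M) (num_states M) (num_symbols M)"
      using that Pair by (auto simp: wf_config_def keys_def read_tape_eq)
    then show ?thesis using Pair by (simp add: N_def table_tm_def table_def)
  qed
  have *: "(step N ^^ s) c = (step M ^^ s) c \<and> wf_config M ((step M ^^ s) c)" if "wf_config M c" for s c
  proof (induction s)
    case 0
    then show ?case using that by simp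
  next
    case (Suc s)
    have "wf_config M (step M d)" if "wf_config M d" for d
      by (cases "fst d = 1"; cases d) (use that wf_config_step[OF assms(1)] in auto)
    then show ?case using Suc step_eq by simp
  qed
  have "init_config N zs = init_config M zs" by (simp add: init_config_def N_def table_tm_def)
  then have eq: "(step N ^^ s) (init_config N zs) = (step M ^^ s) (init_config M zs)" for s
    using *[OF wf_config_init[OF assms(1)]] by simp
  show ?thesis unfolding outcome_def eq
    using assms(2) halts_with_unique by (intro the_equality) blast+
qed

theorem countable_poly_time: "countable {f. poly_time_on UNIV f}"
proof (rule countable_subset[OF _ countable_image[OF countable_table_tms]])
  show "{f. poly_time_on UNIV f} \<subseteq> outcome ` table_tms"
  proof
    fix f assume "f \<in> {f. poly_time_on UNIV f}"
    then obtain M and P :: "nat poly" where M: "valid_tm M"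
      "\<And>zs. \<exists>t\<le>poly P (length (encode_tuple zs)). halts_with ((step M ^^ t) (init_config M zs)) (f zs)"
      unfolding poly_time_on_def by auto
    let ?N = "table_tm (num_tapes M) (num_states M) (num_symbols M) (table M)"
    have "f zs = outcome ?N zs" for zs
    proof -
      obtain t where "halts_with ((step M ^^ t) (init_config M zs)) (f zs)" using M(2) by blast
      from outcome_table_tm[OF M(1) this] show ?thesis by simp
    qed
    then have "f = outcome ?N" by blast
    moreover have "table M \<in> keys (num_tapes M) (num_states M) (num_symbols M) \<rightarrow>\<^sub>E UNIV"
      by (simp add: table_def)
    then have "?N \<in> table_tms" unfolding table_tms_def UN_iff
      by (rule bexI[of _ "num_tapes M", OF bexI[of _ "num_states M", OF bexI[of _ "num_symbols M", OF imageI]]]) simp_all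
    ultimately show "f \<in> outcome ` table_tms" by blast
  qed
qed

section \<open>Diagonalisation\<close>

text \<open>For such a pair no extension of \<open>w\<close> can change on which side of the cut the
  word \<open>z\<close> lies.\<close>

definition decided :: "bool \<Rightarrow> word \<Rightarrow> word \<Rightarrow> bool" where
  "decided p z w \<longleftrightarrow> z \<in> cut p w \<or> w \<in> cut p z"

lemma cut_append: "cut p w \<subseteq> cut p (w @ v)"
  by (auto simp: cut_def nth_append)

lemma cut_append_left: "z \<in> cut p w \<Longrightarrow> z @ v \<in> cut p w"
  unfolding cut_def mem_Collect_eq
  by (elim exE conjE, rule exI, intro conjI) (auto simp: nth_append)

lemma cut_asym: "z \<in> cut p w \<Longrightarrow> w \<notin> cut p z"
proof
  assume "z \<in> cut p w" "w \<in> cut p z"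
  then obtain d e where "even d = p" "\<not> z ! d" "w ! d" "\<forall>k<d. even k = p \<longrightarrow> z ! k = w ! k"
    "even e = p" "\<not> w ! e" "z ! e" "\<forall>k<e. even k = p \<longrightarrow> w ! k = z ! k"
    unfolding cut_def by blast
  then show False by (metis linorder_neqE_nat)
qed

lemma cut_common_prefix:
  assumes "even (length w)" "z \<in> cut p v"
  shows "w @ z \<in> cut p (w @ v)"
proof -
  from assms(2) obtain d where d: "d < length z" "d < length v" "even d = p" "\<not> z ! d" "v ! d"
    "\<forall>e<d. even e = p \<longrightarrow> z ! e = v ! e" by (auto simp: cut_def)
  show ?thesis unfolding cut_def
    using d assms(1) by (auto simp: nth_append intro!: exI[of _ "length w + d"])
qed

text \<open>If \<open>z\<close> lies in a later cut \<open>w j\<close>, then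
  \<open>w i \<in> cut p z\<close> is impossible: it would pass to the extension \<open>w j\<close>
  and contradict asymmetry.\<close>

lemma decided_cut_chain:
  assumes "\<And>i. \<exists>v. w (Suc i) = w i @ v" "decided p z (w i)"
  shows "z \<in> (\<Union>j. cut p (w j)) \<longleftrightarrow> z \<in> cut p (w i)"
proof
  have mono: "\<exists>v. w (i + k) = w i @ v" for i k
  proof (induction k)
    case (Suc k)
    then show ?case using assms(1)[of "i + k"] by (metis add_Suc_right append.assoc)
  qed simp
  assume "z \<in> (\<Union>j. cut p (w j))"
  then obtain j where j: "z \<in> cut p (w j)" by blast
  show "z \<in> cut p (w i)"
  proof (cases "j \<le> i")
    case True
    then show ?thesis using j mono[of j "i - j"] cut_append by fastforce
  next
    case False
    then have "w i \<notin> cut p z" using j mono[of i "j - i"] cut_append_left cut_asym by fastforce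
    then show ?thesis using assms(2) by (simp add: decided_def)
  qed
qed blast

text \<open>Stage \<open>n\<close> asks the \<open>n\<close>-th function for its answer on the words
  \<open>w n @ e\<close>, \<open>e\<close> from \<open>es\<close>, and extends \<open>w n\<close> so
  that this allegedly wrong answer becomes the true one. An answer of the wrong length already
  violates \<open>P_mc\<close>, so in that case any extension of even length will do.\<close>

theorem diagonalise:
  fixes opr :: "bool \<Rightarrow> bool \<Rightarrow> bool" and es :: "word list"
  assumes patterns: "\<And>bs. length bs = length es \<Longrightarrow> \<exists>c. even (length c) \<and>
      (\<forall>e\<in>set es. decided True e c \<and> decided False e c) \<and>
      map (\<lambda>e. opr (e \<in> cut True c) (e \<in> cut False c)) es = bs"
  shows "\<exists>A\<in>P_Sel. \<exists>B\<in>P_Sel. {z. opr (z \<in> A) (z \<in> B)} \<notin> P_mc (length es)"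
proof -
  let ?F = "{f. poly_time_on UNIV f}"
  let ?R = "\<lambda>f w w'. \<exists>c. w' = w @ c \<and> (length (f (map ((@) w) es)) = length es \<longrightarrow>
      (\<forall>e\<in>set es. decided True (w @ e) w' \<and> decided False (w @ e) w') \<and>
      map (\<lambda>e. opr (w @ e \<in> cut True w') (w @ e \<in> cut False w')) es = f (map ((@) w) es))"
  have extend: "\<exists>w'. even (length w') \<and> ?R f w w'" if "even (length w)" for f :: "word list \<Rightarrow> word" and w
  proof (cases "length (f (map ((@) w) es)) = length es")
    case True
    from patterns[OF this] obtain c where c: "even (length c)"
      "\<forall>e\<in>set es. decided True e c \<and> decided False e c"
      "map (\<lambda>e. opr (e \<in> cut True c) (e \<in> cut False c)) es = f (map ((@) w) es)" by blast
    \<comment> \<open>A prefix of even length preserves parities, so a settled comparison stays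
      settled with the same result; asymmetry gives the converse direction of the
      equivalence.\<close>
    have dec: "decided p (w @ e) (w @ c)" "w @ e \<in> cut p (w @ c) \<longleftrightarrow> e \<in> cut p c" if "e \<in> set es" for p e
    proof -
      have "decided p e c" using c(2) that by (cases p) auto
      then show "decided p (w @ e) (w @ c)" "w @ e \<in> cut p (w @ c) \<longleftrightarrow> e \<in> cut p c"
        using cut_common_prefix[OF \<open>even (length w)\<close>] cut_asym by (auto simp: decided_def)
    qed
    show ?thesis
      by (rule exI[of _ "w @ c"]) (use that c dec in \<open>auto cong: map_cong\<close>)
  qed (use that in auto)
  have "\<exists>w. \<forall>n. even (length (w n)) \<and> ?R (from_nat_into ?F n) (w n) (w (Suc n))"
    by (rule dependent_nat_choice[where P = "\<lambda>_ w. even (length w)"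
          and Q = "\<lambda>n. ?R (from_nat_into ?F n)"])
       (use extend in \<open>auto intro: exI[of _ "[]"]\<close>)
  then obtain w :: "nat \<Rightarrow> word" where w: "\<And>n. ?R (from_nat_into ?F n) (w n) (w (Suc n))" by blast
  have chain: "\<exists>v. w (Suc i) = w i @ v" for i using w[of i] by blast
  define A where "A = (\<Union>i. cut True (w i))"
  define B where "B = (\<Union>i. cut False (w i))"
  have "{z. opr (z \<in> A) (z \<in> B)} \<notin> P_mc (length es)"
  proof
    assume "{z. opr (z \<in> A) (z \<in> B)} \<in> P_mc (length es)"
    then obtain f where f: "poly_time_on UNIV f"
      "\<And>zs. length es \<le> length zs \<Longrightarrow> length (f zs) = length zs \<and>
          map (\<lambda>z. z \<in> {z. opr (z \<in> A) (z \<in> B)}) zs \<noteq> f zs"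
      unfolding P_mc_def by blast
    obtain n where n: "from_nat_into ?F n = f"
      using from_nat_into_surj[OF countable_poly_time, of f] f(1) by auto
    let ?zs = "map ((@) (w n)) es"
    have "length (f ?zs) = length es" using f(2)[of ?zs] by simp
    then have *: "\<forall>e\<in>set es. decided True (w n @ e) (w (Suc n)) \<and> decided False (w n @ e) (w (Suc n))"
      "map (\<lambda>e. opr (w n @ e \<in> cut True (w (Suc n))) (w n @ e \<in> cut False (w (Suc n)))) es = f ?zs"
      using w[of n] n by auto
    have "map (\<lambda>z. z \<in> {z. opr (z \<in> A) (z \<in> B)}) ?zs = f ?zs"
      unfolding *(2)[symmetric] A_def B_def
      using *(1) decided_cut_chain[of w _ _ "Suc n", OF chain] by auto
    then show False using f(2)[of ?zs] by simp
  qed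
  then show ?thesis using Union_cut_P_Sel unfolding A_def B_def by blast
qed

text \<open>Words to be classified get odd keys, cuts get even keys, so that no two of them coincide.\<close>

definition bits :: "nat \<Rightarrow> word" where
  "bits n = [n \<ge> 4, n mod 4 \<ge> 2, odd n]"

text \<open>The three bits stand in order of decreasing significance, so lexicographic order is
  numerical order below 8. The first key occupies the even positions.\<close>

definition interleave :: "nat \<Rightarrow> nat \<Rightarrow> word" where
  "interleave m n = concat (map2 (\<lambda>a b. [a, b]) (bits m) (bits n))"

lemma cut_Nil [simp]: "[] \<notin> cut p w" "z \<notin> cut p []"
  by (simp_all add: cut_def)

text \<open>Removing the first letter shifts all positions by one and so flips the parity; position
  0 counts only if \<open>p\<close> holds. As a rewrite rule this evaluates cuts on concrete
  words.\<close>

lemma cut_Cons [simp]: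
  "a # z \<in> cut p (b # w) \<longleftrightarrow> (p \<and> \<not> a \<and> b) \<or> ((p \<longrightarrow> a = b) \<and> z \<in> cut (\<not> p) w)"
proof -
  have ex: "(\<exists>d. P d) \<longleftrightarrow> P 0 \<or> (\<exists>d. P (Suc d))" for P :: "nat \<Rightarrow> bool"
    by (metis not0_implies_Suc)
  show ?thesis
    unfolding cut_def mem_Collect_eq
    by (subst ex) (auto simp: All_less_Suc2)
qed

lemma interleave_in_cut_iff:
  assumes "m < 8" "n < 8" "m' < 8" "n' < 8"
  shows "interleave m n \<in> cut True (interleave m' n') \<longleftrightarrow> m < m'"
    "interleave m n \<in> cut False (interleave m' n') \<longleftrightarrow> n < n'"
proof -
  have *: "m \<in> {0, 1, 2, 3, 4, 5, 6, 7}" if "m < 8" for m :: nat using that by auto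
  show "interleave m n \<in> cut True (interleave m' n') \<longleftrightarrow> m < m'"
    unfolding interleave_def
    using *[OF assms(1)] *[OF assms(3)] by (simp add: bits_def) (elim disjE; simp)
  show "interleave m n \<in> cut False (interleave m' n') \<longleftrightarrow> n < n'"
    unfolding interleave_def
    using *[OF assms(2)] *[OF assms(4)] by (simp add: bits_def) (elim disjE; simp)
qed

section \<open>Lower bounds from small patterns of keys\<close>

theorem not_P_mc_if_separated:
  fixes opr :: "bool \<Rightarrow> bool \<Rightarrow> bool" and ks :: "(nat \<times> nat) list"
  assumes keys: "\<forall>(i, j)\<in>set ks. odd i \<and> odd j \<and> i < 8 \<and> j < 8"
    and sep: "\<And>bs. length bs = length ks \<Longrightarrow>
      \<exists>m\<in>{0, 2, 4, 6}. \<exists>n\<in>{0, 2, 4, 6}. map (\<lambda>(i, j). opr (i < m) (j < n)) ks = bs"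
  shows "\<exists>A\<in>P_Sel. \<exists>B\<in>P_Sel. {z. opr (z \<in> A) (z \<in> B)} \<notin> P_mc (length ks)"
proof -
  have "\<exists>A\<in>P_Sel. \<exists>B\<in>P_Sel. {z. opr (z \<in> A) (z \<in> B)} \<notin> P_mc (length (map (case_prod interleave) ks))"
  proof (rule diagonalise)
    fix bs :: word assume "length bs = length (map (case_prod interleave) ks)"
    then have "length bs = length ks" by simp
    from sep[OF this] obtain m n where mn: "m \<in> {0, 2, 4, 6}" "n \<in> {0, 2, 4, 6}"
      "map (\<lambda>(i, j). opr (i < m) (j < n)) ks = bs" by blast
    have bound: "m < 8" "n < 8" "even m" "even n" using mn by auto
    have "\<forall>(i, j)\<in>set ks. decided True (interleave i j) (interleave m n) \<and>
        decided False (interleave i j) (interleave m n)"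
    proof clarify
      fix i j assume "(i, j) \<in> set ks"
      with keys have "i < 8" "j < 8" "i \<noteq> m" "j \<noteq> n" using bound by auto
      then show "decided True (interleave i j) (interleave m n) \<and> decided False (interleave i j) (interleave m n)"
        using bound by (auto simp: decided_def interleave_in_cut_iff)
    qed
    moreover have "map (\<lambda>e. opr (e \<in> cut True (interleave m n)) (e \<in> cut False (interleave m n)))
        (map (case_prod interleave) ks) = bs"
      unfolding mn(3)[symmetric] using keys bound by (auto simp: interleave_in_cut_iff)
    moreover have "even (length (interleave m n))" by (simp add: interleave_def bits_def)
    ultimately show "\<exists>c. even (length c) \<and>
        (\<forall>e\<in>set (map (case_prod interleave) ks). decided True e c \<and> decided False e c) \<and>
        map (\<lambda>e. opr (e \<in> cut True c) (e \<in> cut False c)) (map (case_prod interleave) ks) = bs"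
      by (intro exI[of _ "interleave m n"]) auto
  qed
  then show ?thesis by simp
qed

text \<open>The two keys order the two words oppositely. The cuts \<open>m = 2\<close>,
  \<open>n = 4\<close> admit only the first word, \<open>m = 4\<close>, \<open>n = 2\<close> only
  the second, \<open>m = n = 4\<close> both and \<open>m = n = 0\<close> none.\<close>

lemma class_and_not_P_mc_2: "\<not> class_and P_Sel P_Sel \<subseteq> P_mc 2"
proof -
  have "\<exists>A\<in>P_Sel. \<exists>B\<in>P_Sel. {z. z \<in> A \<and> z \<in> B} \<notin> P_mc (length [(1::nat, 3::nat), (3, 1)])"
  proof (rule not_P_mc_if_separated)
    fix bs :: word assume "length bs = length [(1::nat, 3::nat), (3, 1)]"
    then obtain a b where "bs = [a, b]" by (auto simp: length_Suc_conv)
    then show "\<exists>m\<in>{0, 2, 4, 6}. \<exists>n\<in>{0, 2, 4, 6}. map (\<lambda>(i, j). i < m \<and> j < n) [(1::nat, 3::nat), (3, 1)] = bs"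
      by (cases a; cases b; auto)
  qed auto
  then obtain A B where "A \<in> P_Sel" "B \<in> P_Sel" "{z. z \<in> A \<and> z \<in> B} \<notin> P_mc 2" by (auto simp: numeral_2_eq_2)
  moreover have "{z. z \<in> A \<and> z \<in> B} = A \<inter> B" by auto
  ultimately show ?thesis unfolding class_and_def by auto
qed

text \<open>With \<open>n = 0\<close>, the cuts \<open>m = 0, 2, 4\<close> admit no word, only the
  first, and both; \<open>m = 0\<close>, \<open>n = 2\<close> admits only the second.\<close>

lemma class_or_not_P_mc_2: "\<not> class_or P_Sel P_Sel \<subseteq> P_mc 2"
proof -
  have "\<exists>A\<in>P_Sel. \<exists>B\<in>P_Sel. {z. z \<in> A \<or> z \<in> B} \<notin> P_mc (length [(1::nat, 3::nat), (3, 1)])"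
  proof (rule not_P_mc_if_separated)
    fix bs :: word assume "length bs = length [(1::nat, 3::nat), (3, 1)]"
    then obtain a b where "bs = [a, b]" by (auto simp: length_Suc_conv)
    then show "\<exists>m\<in>{0, 2, 4, 6}. \<exists>n\<in>{0, 2, 4, 6}. map (\<lambda>(i, j). i < m \<or> j < n) [(1::nat, 3::nat), (3, 1)] = bs"
      by (cases a; cases b; auto)
  qed auto
  then obtain A B where "A \<in> P_Sel" "B \<in> P_Sel" "{z. z \<in> A \<or> z \<in> B} \<notin> P_mc 2" by (auto simp: numeral_2_eq_2)
  moreover have "{z. z \<in> A \<or> z \<in> B} = A \<union> B" by auto
  ultimately show ?thesis unfolding class_or_def by auto
qed

text \<open>The second key orders the words by a cyclic shift of the order of the first. The cuts
  yield the vectors 000, 100, 110, 111 for the first key and 000, 010, 011, 111 for the second, and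
  the sums modulo 2 of one of each run through all eight vectors.\<close>

lemma class_xor_not_P_mc_3: "\<not> class_xor P_Sel P_Sel \<subseteq> P_mc 3"
proof -
  have "\<exists>A\<in>P_Sel. \<exists>B\<in>P_Sel. {z. (z \<in> A) \<noteq> (z \<in> B)} \<notin> P_mc (length [(1::nat, 5::nat), (3, 1), (5, 3)])"
  proof (rule not_P_mc_if_separated)
    fix bs :: word assume "length bs = length [(1::nat, 5::nat), (3, 1), (5, 3)]"
    then obtain a b c where "bs = [a, b, c]" by (auto simp: length_Suc_conv)
    then show "\<exists>m\<in>{0, 2, 4, 6}. \<exists>n\<in>{0, 2, 4, 6}. map (\<lambda>(i, j). (i < m) \<noteq> (j < n)) [(1::nat, 5::nat), (3, 1), (5, 3)] = bs"
      by (cases a; cases b; cases c) simp_all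
  qed auto
  then obtain A B where "A \<in> P_Sel" "B \<in> P_Sel" "{z. (z \<in> A) \<noteq> (z \<in> B)} \<notin> P_mc 3" by (auto simp: numeral_3_eq_3)
  moreover have "{z. (z \<in> A) \<noteq> (z \<in> B)} = A \<inter> - B \<union> - A \<inter> B" by auto
  ultimately show ?thesis unfolding class_xor_def by auto
qed

text \<open>Negation permutes the eight vectors, so the keys used for exclusive or serve
  again.\<close>

lemma class_nxor_not_P_mc_3: "\<not> class_nxor P_Sel P_Sel \<subseteq> P_mc 3"
proof -
  have "\<exists>A\<in>P_Sel. \<exists>B\<in>P_Sel. {z. (z \<in> A) = (z \<in> B)} \<notin> P_mc (length [(1::nat, 5::nat), (3, 1), (5, 3)])"
  proof (rule not_P_mc_if_separated)
    fix bs :: word assume "length bs = length [(1::nat, 5::nat), (3, 1), (5, 3)]"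
    then obtain a b c where "bs = [a, b, c]" by (auto simp: length_Suc_conv)
    then show "\<exists>m\<in>{0, 2, 4, 6}. \<exists>n\<in>{0, 2, 4, 6}. map (\<lambda>(i, j). (i < m) = (j < n)) [(1::nat, 5::nat), (3, 1), (5, 3)] = bs"
      by (cases a; cases b; cases c) simp_all
  qed auto
  then obtain A B where "A \<in> P_Sel" "B \<in> P_Sel" "{z. (z \<in> A) = (z \<in> B)} \<notin> P_mc 3" by (auto simp: numeral_3_eq_3)
  moreover have "{z. (z \<in> A) = (z \<in> B)} = A \<inter> B \<union> - A \<inter> - B" by auto
  ultimately show ?thesis unfolding class_nxor_def by auto
qed

section \<open>Calling a machine and comparing its output\<close>

text \<open>
  A machine may halt with its output head anywhere. An additional tape, whose head moves along with
  the output head, marks the visited cells and the origin, so that the head can be brought back.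
\<close>

definition shadow_tm :: "tm \<Rightarrow> tm" where
  "shadow_tm M = (let k = num_tapes M in mk_tm (Suc k) (num_states M) (num_symbols M)
     (\<lambda>q xs. apsnd (\<lambda>acts. acts @ [(if xs ! k = 0 then 1 else xs ! k, snd (acts ! 1))])
       (trans M q (take k xs))))"

lemma shadow_tm_simps [simp]:
  "num_tapes (shadow_tm M) = Suc (num_tapes M)" "num_states (shadow_tm M) = num_states M"
  "num_symbols (shadow_tm M) = num_symbols M"
  by (simp_all add: shadow_tm_def Let_def)

lemma valid_shadow_tm: "valid_tm M \<Longrightarrow> valid_tm (shadow_tm M)"
  unfolding shadow_tm_def Let_def by (rule valid_mk_tm) (auto simp: valid_tm_def)

text \<open>Symbol 3 marks the origin and 1 the other cells on which the machine has acted. The head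
  may stand one cell outside the interval, on a cell that is still blank.\<close>

definition marked :: "int \<Rightarrow> int \<Rightarrow> int \<Rightarrow> nat" where
  "marked a b i = (if i = 0 then 3 else if a \<le> i \<and> i \<le> b then 1 else 0)"

lemma marked_visit:
  assumes "a \<le> 0" "0 \<le> b" "a - 1 \<le> h" "h \<le> b + 1"
  shows "(marked a b)(h := if marked a b h = 0 then 1 else marked a b h) = marked (min a h) (max b h)"
  using assms by (auto simp: marked_def fun_eq_iff)

lemma step_shadow_tm:
  assumes "valid_tm M" "wf_config M (q, ts)" "q \<noteq> 1" "snd (ts ! 1) = h"
    and "a \<le> 0" "0 \<le> b" "a - 1 \<le> h" "h \<le> b + 1" "step M (q, ts) = (q', us)"
  shows "step (shadow_tm M) (q, ts @ [(marked a b, h)]) =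
    (q', us @ [(marked (min a h) (max b h), snd (us ! 1))]) \<and> \<bar>snd (us ! 1) - h\<bar> \<le> 1"
proof -
  obtain acts where tr: "trans M q (map read_tape ts) = (q', acts)" and us: "us = map2 act acts ts"
    using assms(3,9) by (auto split: prod.splits)
  note v = valid_transD[OF assms(1-3) tr]
  have len: "length ts = num_tapes M" using assms(2) by (simp add: wf_config_def)
  have M: "2 \<le> num_tapes M" "4 \<le> num_symbols M" using assms(1) by (auto simp: valid_tm_def)
  let ?s = "if marked a b h = 0 then 1 else marked a b h"
  have "step (shadow_tm M) (q, ts @ [(marked a b, h)]) =
      (q', map2 act (acts @ [(?s, snd (acts ! 1))]) (ts @ [(marked a b, h)]))"
    unfolding shadow_tm_def Let_def
  proof (rule step_mk_tm)
    show "fst ` set (acts @ [(?s, snd (acts ! 1))]) \<subseteq> {..<num_symbols M}"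
      using v(3) M(2) by (auto simp: marked_def)
  qed (use assms(3) tr v len in \<open>auto simp: nth_append\<close>)
  also have "\<dots> = (q', us @ [((marked a b)(h := ?s), h + offset (snd (acts ! 1)))])"
    using us v len by simp
  also have "h + offset (snd (acts ! 1)) = snd (us ! 1)"
    using us v len M assms(4) by (simp add: snd_act)
  finally have "step (shadow_tm M) (q, ts @ [(marked a b, h)]) =
      (q', us @ [(marked (min a h) (max b h), snd (us ! 1))])"
    using marked_visit[OF assms(5-8)] by simp
  moreover have "snd (us ! 1) - h = offset (snd (acts ! 1))"
    using us v len M assms(4) by (simp add: snd_act)
  moreover have "\<bar>offset m\<bar> \<le> 1" for m by (cases m) auto
  ultimately show ?thesis by simp
qed

text \<open>Each step extends the marked interval by at most one cell at either end; this bounds the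
  way back to the origin by the running time.\<close>

lemma reach_shadow_tm:
  assumes "reach M n c c'" "valid_tm M" "wf_config M c" "snd (snd c ! 1) = h"
    and "a \<le> 0" "0 \<le> b" "a - 1 \<le> h" "h \<le> b + 1"
  shows "\<exists>a' b' h'. reach (shadow_tm M) n (fst c, snd c @ [(marked a b, h)]) (fst c', snd c' @ [(marked a' b', h')]) \<and>
    snd (snd c' ! 1) = h' \<and> a' \<le> 0 \<and> 0 \<le> b' \<and> a' - 1 \<le> h' \<and> h' \<le> b' + 1 \<and> a - int n \<le> a' \<and> b' \<le> b + int n"
  using assms(1,3-8)
proof (induction arbitrary: a b h rule: reach.induct)
  case (reach_refl c)
  then show ?case by (metis reach.reach_refl diff_zero add_0_right of_nat_0 order_refl)
next
  case (reach_step c n c')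
  obtain q ts where c: "c = (q, ts)" by (cases c)
  obtain q' us where st: "step M (q, ts) = (q', us)" by fastforce
  have *: "step (shadow_tm M) (q, ts @ [(marked a b, h)]) =
      (q', us @ [(marked (min a h) (max b h), snd (us ! 1))])" "\<bar>snd (us ! 1) - h\<bar> \<le> 1"
    using step_shadow_tm[OF assms(2) _ _ _ _ _ _ _ st, of h a b] reach_step.prems reach_step.hyps(1) c by auto
  have "wf_config M (q', us)"
    using wf_config_step[OF assms(2) reach_step.prems(1) reach_step.hyps(1)] c st by metis
  moreover have stc: "step M c = (q', us)" using st c by simp
  moreover have "min a h \<le> 0" "0 \<le> max b h" "min a h - 1 \<le> snd (us ! 1)" "snd (us ! 1) \<le> max b h + 1"
    using reach_step.prems(3,4) *(2) by linarith+
  ultimately obtain a' b' h' where IH: "reach (shadow_tm M) n (q', us @ [(marked (min a h) (max b h), snd (us ! 1))])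
      (fst c', snd c' @ [(marked a' b', h')])"
    "snd (snd c' ! 1) = h'" "a' \<le> 0" "0 \<le> b'" "a' - 1 \<le> h'" "h' \<le> b' + 1"
    "min a h - int n \<le> a'" "b' \<le> max b h + int n"
    using reach_step.IH[unfolded stc, of "snd (us ! 1)" "min a h" "max b h"]
    unfolding fst_conv snd_conv by blast
  have "reach (shadow_tm M) (Suc n) (fst c, snd c @ [(marked a b, h)]) (fst c', snd c' @ [(marked a' b', h')])"
    by (rule reach.reach_step) (use c *(1) IH(1) reach_step.hyps(1) in \<open>auto simp del: step.simps\<close>)
  moreover have "a - int (Suc n) \<le> a'" "b' \<le> b + int (Suc n)"
    using IH(7,8) reach_step.prems(5,6) by linarith+
  ultimately show ?case using IH by blast
qed

text \<open>Of the tapes handed to the machine, only its output tape and the shadow tape are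
  described afterwards. The others may hold anything and are never reused.\<close>

lemma exec_Call_shadow:
  assumes M: "valid_tm M" and halt: "halts_with ((step M ^^ t) (init_config M zs)) w"
    and ts: "ts i = (written (encode_tuple zs), 0)"
      "\<And>l. i < l \<Longrightarrow> l < i + num_tapes M \<Longrightarrow> ts l = (written [], 0)"
      "ts (i + num_tapes M) = (marked 0 0, 0)"
  shows "\<exists>us h a b. exec (Call (shadow_tm M) i) ts t us \<and>
    us (i + 1) = (written (letters w), h) \<and> us (i + num_tapes M) = (marked a b, h) \<and>
    a \<le> 0 \<and> 0 \<le> b \<and> a - 1 \<le> h \<and> h \<le> b + 1 \<and> - int t \<le> a \<and> b \<le> int t \<and>
    (\<forall>l. l < i \<or> i + num_tapes M < l \<longrightarrow> us l = ts l)"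
proof -
  let ?k = "num_tapes M"
  have k: "2 \<le> ?k" "4 \<le> num_symbols M" using M by (auto simp: valid_tm_def)
  obtain vs where vs: "(step M ^^ t) (init_config M zs) = (1, vs)" "fst (vs ! 1) = written (letters w)"
    using halt by (cases "(step M ^^ t) (init_config M zs)") (auto simp: halts_with_def)
  from reach_halting[OF vs(1)] obtain n where n: "n \<le> t" "reach M n (init_config M zs) (1, vs)" by blast
  have wf: "wf_config M (init_config M zs)" using M by (rule wf_config_init)
  have init: "init_config M zs = (0, block ts i ?k)"
    unfolding init_config_def
    by (auto simp: block_def nth_Cons ts(1) split: nat.splits intro!: nth_equalityI)
       (use k ts in auto)
  have lenvs: "length vs = ?k" using wf_config_reach[OF n(2) M wf] by (simp add: wf_config_def)
  have "snd (snd (init_config M zs) ! 1) = 0"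
    using k by (auto simp: init_config_def nth_Cons')
  from reach_shadow_tm[OF n(2) M wf this, of 0 0] obtain a b h where
    r: "reach (shadow_tm M) n (0, block ts i ?k @ [(marked 0 0, 0)]) (1, vs @ [(marked a b, h)])"
    and h: "snd (vs ! 1) = h" "a \<le> 0" "0 \<le> b" "a - 1 \<le> h" "h \<le> b + 1" "- int n \<le> a" "b \<le> int n"
    using init by auto
  have blk: "block ts i (Suc ?k) = block ts i ?k @ [(marked 0 0, 0)]"
    using ts(3) by (simp add: block_def)
  let ?us = "\<lambda>j. if i \<le> j \<and> j < i + num_tapes (shadow_tm M) then (vs @ [(marked a b, h)]) ! (j - i) else ts j"
  have "wf_config (shadow_tm M) (0, block ts i (num_tapes (shadow_tm M)))"
    using wf k unfolding init by (auto simp: wf_config_def blk marked_def)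
  then have "exec (Call (shadow_tm M) i) ts n ?us"
    by (rule exec_Call) (use r blk in simp)
  then have "exec (Call (shadow_tm M) i) ts t ?us" using n(1) by (rule exec_weaken)
  moreover have "?us (i + 1) = (written (letters w), h)"
    using k lenvs vs(2) h(1) by (auto simp: nth_append prod_eq_iff)
  moreover have "?us (i + ?k) = (marked a b, h)"
    using lenvs by (simp add: nth_append)
  ultimately show ?thesis using h n(1)
    by (intro exI[of _ ?us] exI[of _ h] exI[of _ a] exI[of _ b]) auto
qed

text \<open>The cell on which the machine halted may be unmarked, so it is marked first. Then the
  marks form one interval containing both head and origin: going left ends just outside it, and
  going right from there meets the only 3.\<close>

definition Home :: "nat \<Rightarrow> nat \<Rightarrow> prog" where
  "Home i j = Put j (\<lambda>r. if r j = 0 then 1 else r j) Stay ;;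
     While (\<lambda>r. r j \<noteq> 0) (Move j Left ;; Move i Left) ;; Move j Right ;; Move i Right ;;
     While (\<lambda>r. r j \<noteq> 3) (Move j Right ;; Move i Right)"

lemma exec_Home:
  assumes "ts i = (c, h)" "ts j = (marked a b, h)" "i \<noteq> j"
    and "a \<le> 0" "0 \<le> b" "a - 1 \<le> h" "h \<le> b + 1" "- int t \<le> a" "b \<le> int t"
  shows "\<exists>us. exec (Home i j) ts (9 * t + 20) us \<and> us i = (c, 0) \<and> (\<forall>l. l \<noteq> i \<and> l \<noteq> j \<longrightarrow> us l = ts l)"
proof -
  define a' where "a' = min a h"
  define b' where "b' = max b h"
  define S where "S = (\<lambda>h. ts(j := (marked a' b', h), i := (c, h)))"
  have ab: "a' \<le> 0" "0 \<le> b'" "a' \<le> h" "h \<le> b'" "- int t - 1 \<le> a'" "b' \<le> int t + 1"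
    using assms by (auto simp: a'_def b'_def)
  have S [simp]: "S l i = (c, l)" "S l j = (marked a' b', l)" for l
    using assms(3) by (auto simp: S_def)
  have move: "exec (Move j m ;; Move i m) (S l) (1 + 1) (S (l + offset m))" for l m
    by (rule exec_cong[OF exec_Seq[OF exec_Move exec_Move]])
       (use assms(3) in \<open>auto simp: S_def fun_eq_iff\<close>)
  have "exec (Put j (\<lambda>r. if r j = 0 then 1 else r j) Stay) ts 1 (S h)"
    by (rule exec_cong[OF exec_Put_eq])
       (use assms(1-3) marked_visit[OF assms(4-7)] in \<open>auto simp: S_def a'_def b'_def intro!: ext\<close>)
  moreover
  define m where "m = nat (h - a' + 1)"
  have "exec (While (\<lambda>r. r j \<noteq> 0) (Move j Left ;; Move i Left)) (S (h - int 0)) (m * Suc (1 + 1) + 1) (S (h - int m))"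
  proof (rule exec_While_iterate[of _ _ "\<lambda>k. S (h - int k)"], intro conjI)
    fix k assume "k < m"
    then show "reads (S (h - int k)) j \<noteq> 0" using ab by (auto simp: marked_def m_def)
    show "exec (Move j Left ;; Move i Left) (S (h - int k)) (1 + 1) (S (h - int (Suc k)))"
      using move[of Left "h - int k"] by (simp add: algebra_simps)
  qed (use ab in \<open>auto simp: marked_def m_def\<close>)
  then have "exec (While (\<lambda>r. r j \<noteq> 0) (Move j Left ;; Move i Left)) (S h) (m * 3 + 1) (S (a' - 1))"
    using ab by (simp add: m_def numeral_3_eq_3)
  moreover have 3: "exec (Move j Right) (S (a' - 1)) 1 ((S (a' - 1))(j := (marked a' b', a')))"
    by (rule exec_cong[OF exec_Move]) auto
  moreover have 4: "exec (Move i Right) ((S (a' - 1))(j := (marked a' b', a'))) 1 (S a')"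
    by (rule exec_cong[OF exec_Move]) (use assms(3) in \<open>auto simp: S_def fun_eq_iff\<close>)
  moreover
  define n where "n = nat (- a')"
  have "exec (While (\<lambda>r. r j \<noteq> 3) (Move j Right ;; Move i Right)) (S (a' + int 0)) (n * Suc (1 + 1) + 1) (S (a' + int n))"
  proof (rule exec_While_iterate[of _ _ "\<lambda>k. S (a' + int k)"], intro conjI)
    fix k assume "k < n"
    then show "reads (S (a' + int k)) j \<noteq> 3" using ab by (auto simp: marked_def n_def)
    show "exec (Move j Right ;; Move i Right) (S (a' + int k)) (1 + 1) (S (a' + int (Suc k)))"
      using move[of Right "a' + int k"] by (simp add: algebra_simps)
  qed (use ab in \<open>auto simp: marked_def n_def\<close>)
  then have "exec (While (\<lambda>r. r j \<noteq> 3) (Move j Right ;; Move i Right)) (S a') (n * 3 + 1) (S 0)"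
    using ab by (simp add: n_def numeral_3_eq_3)
  ultimately have "exec (Home i j) ts (1 + ((m * 3 + 1) + (1 + (1 + (n * 3 + 1))))) (S 0)"
    unfolding Home_def by (intro exec_Seq)
  \<comment> \<open>The heads go left at worst from \<open>t + 1\<close> to \<open>- t - 2\<close>,
    and then right from \<open>- t - 1\<close> to 0.\<close>
  moreover have "m \<le> 2 * t + 3" "n \<le> t + 1" using ab by (auto simp: m_def n_def)
  ultimately have "exec (Home i j) ts (9 * t + 20) (S 0)"
    by (elim exec_weaken) simp
  then show ?thesis using S by (auto intro!: exI[of _ "S 0"] simp: S_def)
qed

text \<open>After the loop, equal symbols can only be two blanks. Tape \<open>i\<close> is rewound
  in both branches because later comparisons use the same word; tape \<open>j\<close> is
  scratch.\<close>

definition Compare :: "nat \<Rightarrow> nat \<Rightarrow> prog \<Rightarrow> prog \<Rightarrow> prog" where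
  "Compare i j p q = While (\<lambda>r. r i = r j \<and> r i \<noteq> 0) (Move i Right ;; Move j Right) ;;
     Cond (\<lambda>r. r i = r j) (Rewind i ;; p) (Rewind i ;; q)"

lemma exec_Compare:
  assumes "ts i = (written (letters x), 0)" "ts j = (written (letters w), 0)" "i \<noteq> j"
    and "\<And>us. (\<And>l. l \<noteq> j \<Longrightarrow> us l = ts l) \<Longrightarrow> \<exists>vs. exec (if w = x then p else q) us b vs \<and> R vs"
  shows "\<exists>vs. exec (Compare i j p q) ts (5 * length x + 10 + b) vs \<and> R vs"
proof -
  let ?stop = "\<lambda>k. length x \<le> k \<or> length w \<le> k \<or> x ! k \<noteq> w ! k"
  define n where "n = (LEAST k. ?stop k)"
  have at: "?stop n" unfolding n_def by (rule LeastI[of ?stop "length x"]) simp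
  have below: "k < length x" "k < length w" "x ! k = w ! k" if "k < n" for k
    using not_less_Least[OF that[unfolded n_def]] by auto
  have n: "n \<le> length x" unfolding n_def by (rule Least_le) simp
  have n': "n \<le> length w" unfolding n_def by (rule Least_le) simp
  define S where "S = (\<lambda>k. ts(i := (written (letters x), int k), j := (written (letters w), int k)))"
  have S [simp]: "S k i = (written (letters x), int k)" "S k j = (written (letters w), int k)" for k
    using assms(3) by (auto simp: S_def)
  have 1: "exec (While (\<lambda>r. r i = r j \<and> r i \<noteq> 0) (Move i Right ;; Move j Right)) (S 0) (n * Suc (1 + 1) + 1) (S n)"
  proof (rule exec_While_iterate, intro conjI)
    fix k assume "k < n"
    note * = below[OF this]
    show "reads (S k) i = reads (S k) j" "reads (S k) i \<noteq> 0" using * by (auto simp: written_nth nth_letters)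
    show "exec (Move i Right ;; Move j Right) (S k) (1 + 1) (S (Suc k))"
      by (rule exec_cong[OF exec_Seq[OF exec_Move exec_Move]])
         (use assms(3) in \<open>auto simp: S_def fun_eq_iff\<close>)
  qed (use at n n' in \<open>auto simp: written_nth nth_letters\<close>)
  have test: "reads (S n) i = reads (S n) j \<longleftrightarrow> w = x"
  proof
    assume "reads (S n) i = reads (S n) j"
    with at n n' have "n = length x" "n = length w"
      by (auto simp: written_nth nth_letters split: if_splits)
    with below show "w = x" by (auto intro: nth_equalityI)
  qed auto
  let ?T = "(S n)(i := (written (letters x), 0))"
  have 2: "exec (Rewind i) (S n) (2 * n + 3) ?T"
    by (rule exec_Rewind) (use n in auto)
  have "\<exists>vs. exec (if w = x then p else q) ?T b vs \<and> R vs"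
    by (rule assms(4)) (use assms(1,3) in \<open>auto simp: S_def\<close>)
  then obtain vs where vs: "exec (if w = x then p else q) ?T b vs" "R vs" by blast
  have "exec (if reads (S n) i = reads (S n) j then Rewind i ;; p else Rewind i ;; q) (S n) (2 * n + 3 + b) vs"
    unfolding test using exec_Seq[OF 2 vs(1)] by (simp split: if_splits)
  from exec_Cond[of "\<lambda>r. r i = r j", OF this] have "exec (Compare i j p q) (S 0) (n * Suc (1 + 1) + 1 + Suc (2 * n + 3 + b)) vs"
    unfolding Compare_def by (rule exec_Seq[OF 1])
  moreover have "S 0 = ts" using assms(1-3) by (auto simp: S_def fun_eq_iff)
  ultimately have "exec (Compare i j p q) ts (5 * length x + 10 + b) vs"
    using n by (auto elim!: exec_weaken)
  with vs(2) show ?thesis by blast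
qed

text \<open>The copied pair puts the called machine into exactly its initial configuration, and the
  3 on tape \<open>s\<close> is the origin mark of \<open>marked 0 0\<close>.\<close>

definition Prep :: "nat \<Rightarrow> nat \<Rightarrow> nat \<Rightarrow> nat \<Rightarrow> prog" where
  "Prep i j d s = Copy i d (\<lambda>s. s = 0) ;; Put d (\<lambda>_. 3) Right ;;
     Copy j d (\<lambda>s. s = 0) ;; Put d (\<lambda>_. 3) Right ;;
     Rewind d ;; Rewind i ;; Rewind j ;; Put s (\<lambda>_. 3) Stay"

lemma exec_Prep:
  assumes "ts i = (written (letters x), 0)" "ts j = (written (letters y), 0)"
    and "ts d = (written [], 0)" "ts s = (written [], 0)" "distinct [i, j, d, s]"
  shows "exec (Prep i j d s) ts (7 * (length x + length y) + 30)
    (ts(d := (written (encode_tuple [x, y]), 0), s := (marked 0 0, 0)))"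
proof -
  let ?X = "written (letters x)" and ?Y = "written (letters y)" and ?B = "(written [], 0)"
  let ?m = "int (length x)" and ?n = "int (length y)"
  define S where "S = (\<lambda>a b e f. ts(i := a, j := b, d := e, s := f))"
  have S [simp]: "S a b e f i = a" "S a b e f j = b" "S a b e f d = e" "S a b e f s = f" for a b e f
    using assms(5) by (auto simp: S_def)
  have upd [simp]: "(S a b e f)(i := g) = S g b e f" "(S a b e f)(j := g) = S a g e f"
    "(S a b e f)(d := g) = S a b g f" "(S a b e f)(s := g) = S a b e g" for a b e f g
    using assms(5) by (auto simp: S_def fun_eq_iff)
  have ts: "ts = S (?X, 0) (?Y, 0) ?B ?B" using assms by (auto simp: S_def fun_eq_iff)
  have 1: "exec (Copy i d (\<lambda>s. s = 0)) (S (?X, 0) (?Y, 0) ?B ?B) (3 * length x + 1)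
      (S (?X, ?m) (?Y, 0) (?X, ?m) ?B)"
    by (rule exec_cong[OF exec_Copy[where xs = "letters x" and ys = "[]" and c = ?X and h = 0]])
       (use assms(5) in \<open>auto simp: nth_letters written_nth\<close>)
  let ?U = "written (letters x @ [3])" and ?V = "written (letters x @ [3] @ letters y)"
  have 2: "exec (Put d (\<lambda>_. 3) Right) (S (?X, ?m) (?Y, 0) (?X, ?m) ?B) 1
      (S (?X, ?m) (?Y, 0) (?U, ?m + 1) ?B)"
    by (rule exec_cong[OF exec_Put_eq]) (use written_snoc[of "letters x" 3] in auto)
  have 3: "exec (Copy j d (\<lambda>s. s = 0)) (S (?X, ?m) (?Y, 0) (?U, ?m + 1) ?B) (3 * length y + 1)
      (S (?X, ?m) (?Y, ?n) (?V, ?m + 1 + ?n) ?B)"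
    by (rule exec_cong[OF exec_Copy[where xs = "letters y" and ys = "letters x @ [3]" and c = ?Y and h = 0]])
       (use assms(5) in \<open>auto simp: nth_letters written_nth algebra_simps\<close>)
  let ?W = "written (encode_tuple [x, y])"
  have 4: "exec (Put d (\<lambda>_. 3) Right) (S (?X, ?m) (?Y, ?n) (?V, ?m + 1 + ?n) ?B) 1
      (S (?X, ?m) (?Y, ?n) (?W, int (length x + length y + 2)) ?B)"
    by (rule exec_cong[OF exec_Put_eq])
       (use written_snoc[of "letters x @ [3] @ letters y" 3] in \<open>auto simp: algebra_simps\<close>)
  have 5: "exec (Rewind d) (S (?X, ?m) (?Y, ?n) (?W, int (length x + length y + 2)) ?B)
      (2 * (length x + length y + 2) + 3) (S (?X, ?m) (?Y, ?n) (?W, 0) ?B)"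
    by (rule exec_cong[OF exec_Rewind[where xs = "encode_tuple [x, y]" and k = "length x + length y + 2"]]) auto
  have 6: "exec (Rewind i) (S (?X, ?m) (?Y, ?n) (?W, 0) ?B) (2 * length x + 3) (S (?X, 0) (?Y, ?n) (?W, 0) ?B)"
    by (rule exec_cong[OF exec_Rewind[where xs = "letters x" and k = "length x"]]) auto
  have 7: "exec (Rewind j) (S (?X, 0) (?Y, ?n) (?W, 0) ?B) (2 * length y + 3) (S (?X, 0) (?Y, 0) (?W, 0) ?B)"
    by (rule exec_cong[OF exec_Rewind[where xs = "letters y" and k = "length y"]]) auto
  have "(written [])(0 := 3) = marked 0 0" by (auto simp: written_def marked_def fun_eq_iff)
  then have 8: "exec (Put s (\<lambda>_. 3) Stay) (S (?X, 0) (?Y, 0) (?W, 0) ?B) 1 (S (?X, 0) (?Y, 0) (?W, 0) (marked 0 0, 0))"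
    by (intro exec_cong[OF exec_Put_eq]) auto
  have "exec (Prep i j d s) ts (7 * (length x + length y) + 30) (S (?X, 0) (?Y, 0) (?W, 0) (marked 0 0, 0))"
    unfolding Prep_def ts
    by (rule exec_weaken[OF exec_Seq[OF 1 exec_Seq[OF 2 exec_Seq[OF 3 exec_Seq[OF 4
          exec_Seq[OF 5 exec_Seq[OF 6 exec_Seq[OF 7 8]]]]]]]]) simp
  moreover have "S (?X, 0) (?Y, 0) (?W, 0) (marked 0 0, 0) = ts(d := (?W, 0), s := (marked 0 0, 0))"
    using assms by (auto simp: S_def fun_eq_iff)
  ultimately show ?thesis by simp
qed

definition Duel :: "tm \<Rightarrow> nat \<Rightarrow> nat \<Rightarrow> nat \<Rightarrow> prog \<Rightarrow> prog \<Rightarrow> prog" where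
  "Duel M d i j p q = Prep i j d (d + num_tapes M) ;; Call (shadow_tm M) d ;;
     Home (d + 1) (d + num_tapes M) ;; Compare i (d + 1) p q"

lemma wf_Duel:
  assumes "valid_tm M" "d + num_tapes M < K" "num_symbols M \<le> G" "i < K" "j < K"
    and "wf_prog K G p" "wf_prog K G q"
  shows "wf_prog K G (Duel M d i j p q)"
proof -
  have "2 \<le> num_tapes M" "4 \<le> G" using assms(1,3) by (auto simp: valid_tm_def)
  then show ?thesis using assms valid_shadow_tm[OF assms(1)]
    by (auto simp: Duel_def Prep_def Home_def Compare_def)
qed

text \<open>Stated in continuation style: the contents of the scratch tapes after the call are
  unknown, so \<open>cont\<close> must serve every store that agrees with \<open>ts\<close> on the
  other tapes.\<close>

lemma exec_Duel:
  assumes M: "valid_tm M" and halt: "halts_with ((step M ^^ t) (init_config M [x, y])) w"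
    and ij: "ts i = (written (letters x), 0)" "ts j = (written (letters y), 0)" "i \<noteq> j" "i < d" "j < d"
    and fresh: "\<And>l. d \<le> l \<Longrightarrow> l \<le> d + num_tapes M \<Longrightarrow> ts l = (written [], 0)"
    and cont: "\<And>us. (\<And>l. l < d \<or> d + num_tapes M < l \<Longrightarrow> us l = ts l) \<Longrightarrow>
      \<exists>vs. exec (if w = x then p else q) us b vs \<and> R vs"
  shows "\<exists>vs. exec (Duel M d i j p q) ts (12 * (length x + length y) + 10 * t + 60 + b) vs \<and> R vs"
proof -
  let ?k = "num_tapes M"
  have k: "2 \<le> ?k" using M by (simp add: valid_tm_def)
  let ?t1 = "ts(d := (written (encode_tuple [x, y]), 0), d + ?k := (marked 0 0, 0))"
  have 1: "exec (Prep i j d (d + ?k)) ts (7 * (length x + length y) + 30) ?t1"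
    by (rule exec_Prep) (use ij fresh k in auto)
  have "\<exists>us h a b. exec (Call (shadow_tm M) d) ?t1 t us \<and>
      us (d + 1) = (written (letters w), h) \<and> us (d + ?k) = (marked a b, h) \<and>
      a \<le> 0 \<and> 0 \<le> b \<and> a - 1 \<le> h \<and> h \<le> b + 1 \<and> - int t \<le> a \<and> b \<le> int t \<and>
      (\<forall>l. l < d \<or> d + ?k < l \<longrightarrow> us l = ?t1 l)"
    by (rule exec_Call_shadow[OF M halt]) (use k fresh in auto)
  then obtain t2 h a e where 2: "exec (Call (shadow_tm M) d) ?t1 t t2"
    and t2: "t2 (d + 1) = (written (letters w), h)" "t2 (d + ?k) = (marked a e, h)"
      "a \<le> 0" "0 \<le> e" "a - 1 \<le> h" "h \<le> e + 1" "- int t \<le> a" "e \<le> int t"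
      "\<forall>l. l < d \<or> d + ?k < l \<longrightarrow> t2 l = ?t1 l" by blast
  have "d + 1 \<noteq> d + ?k" using k by simp
  from exec_Home[OF t2(1,2) this t2(3-8)] obtain t3 where 3: "exec (Home (d + 1) (d + ?k)) t2 (9 * t + 20) t3"
    and t3: "t3 (d + 1) = (written (letters w), 0)" "\<forall>l. l \<noteq> d + 1 \<and> l \<noteq> d + ?k \<longrightarrow> t3 l = t2 l" by blast
  have out: "t3 l = ts l" if "l < d \<or> d + ?k < l" for l
    using that t2(9) t3(2) k by auto
  have "\<exists>vs. exec (Compare i (d + 1) p q) t3 (5 * length x + 10 + b) vs \<and> R vs"
  proof (rule exec_Compare)
    show "t3 i = (written (letters x), 0)" using out ij by simp
    fix us :: store assume us: "\<And>l. l \<noteq> d + 1 \<Longrightarrow> us l = t3 l"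
    show "\<exists>vs. exec (if w = x then p else q) us b vs \<and> R vs"
      by (rule cont) (use us out k in auto)
  qed (use t3(1) ij in auto)
  then obtain vs where 4: "exec (Compare i (d + 1) p q) t3 (5 * length x + 10 + b) vs" "R vs" by blast
  have "exec (Duel M d i j p q) ts (12 * (length x + length y) + 10 * t + 60 + b) vs"
    unfolding Duel_def
    by (rule exec_weaken[OF exec_Seq[OF 1 exec_Seq[OF 2 exec_Seq[OF 3 4(1)]]]]) simp
  with 4(2) show ?thesis by blast
qed

section \<open>Conjunctions and disjunctions of P-selective sets\<close>

text \<open>The first component is the candidate kept by the round: the winner for intersections
  (\<open>c = False\<close>), the loser for unions (\<open>c = True\<close>).\<close>

definition choice :: "bool \<Rightarrow> bool \<Rightarrow> nat \<Rightarrow> nat \<Rightarrow> nat \<times> nat" where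
  "choice c won i j = (if won \<noteq> c then (i, j) else (j, i))"

definition Round :: "bool \<Rightarrow> tm \<Rightarrow> nat \<Rightarrow> nat \<Rightarrow> nat \<Rightarrow> (nat \<times> nat \<Rightarrow> prog) \<Rightarrow> prog" where
  "Round c M d i j C = Duel M d i j (C (choice c True i j)) (C (choice c False i j))"

lemma exec_Round:
  assumes "valid_tm M" "halts_with ((step M ^^ t) (init_config M [x, y])) w"
    and "ts i = (written (letters x), 0)" "ts j = (written (letters y), 0)" "i \<noteq> j" "i < d" "j < d"
    and "\<And>l. d \<le> l \<Longrightarrow> l \<le> d + num_tapes M \<Longrightarrow> ts l = (written [], 0)"
    and "\<And>us. (\<And>l. l < d \<or> d + num_tapes M < l \<Longrightarrow> us l = ts l) \<Longrightarrow>
      \<exists>vs. exec (C (choice c (w = x) i j)) us b vs \<and> R vs"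
  shows "\<exists>vs. exec (Round c M d i j C) ts (12 * (length x + length y) + 10 * t + 60 + b) vs \<and> R vs"
  unfolding Round_def
proof (rule exec_Duel[OF assms(1-8)])
  fix us :: store assume "\<And>l. l < d \<or> d + num_tapes M < l \<Longrightarrow> us l = ts l"
  from assms(9)[OF this] show "\<exists>vs. exec (if w = x then C (choice c True i j) else C (choice c False i j)) us b vs \<and> R vs"
    by (cases "w = x") auto
qed

section \<open>Reading the components of a tuple and writing the prediction\<close>

definition component :: "word list \<Rightarrow> nat \<Rightarrow> word" where
  "component zs n = (if n < length zs then zs ! n else [])"

text \<open>Beyond the last component, every further \<open>Load\<close> moves the head by one blank cell.\<close>

definition pos :: "word list \<Rightarrow> nat \<Rightarrow> nat" where
  "pos zs n = length (encode_tuple (take n zs)) + (n - length zs)"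

lemma encode_tuple_append: "encode_tuple (xs @ ys) = encode_tuple xs @ encode_tuple ys"
  by (simp add: encode_tuple_def)

lemma written_pos:
  "written (encode_tuple zs) (int (pos zs n) + int k) =
     (if k < length (encode_tuple (drop n zs)) then encode_tuple (drop n zs) ! k else 0)"
proof -
  have "encode_tuple zs = encode_tuple (take n zs) @ encode_tuple (drop n zs)"
    using encode_tuple_append[of "take n zs" "drop n zs"] by simp
  moreover have "written (encode_tuple zs) (int (pos zs n + k)) =
     (if k < length (encode_tuple (drop n zs)) then encode_tuple (drop n zs) ! k else 0)"
    unfolding written_nth pos_def
    by (subst (1 2) calculation, cases "n \<le> length zs") (auto simp: nth_append)
  ultimately show ?thesis by simp
qed

lemma pos_Suc: "pos zs (Suc n) = pos zs n + length (component zs n) + 1"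
  by (auto simp: pos_def component_def take_Suc_conv_app_nth encode_tuple_append)

lemma drop_component:
  "n < length zs \<Longrightarrow> encode_tuple (drop n zs) = letters (component zs n) @ 3 # encode_tuple (drop (Suc n) zs)"
  by (simp add: component_def flip: Cons_nth_drop_Suc)

lemma length_component: "length (component zs n) \<le> length (encode_tuple zs)"
proof (cases "n < length zs")
  case True
  have "length (encode_tuple (drop n zs)) \<le> length (encode_tuple zs)"
    using encode_tuple_append[of "take n zs" "drop n zs"] by simp
  then show ?thesis using drop_component[OF True] by simp
qed (simp add: component_def)

definition Load :: "nat \<Rightarrow> prog" where
  "Load i = Copy 0 i (\<lambda>s. s = 0 \<or> s = 3) ;; Move 0 Right ;; Rewind i"

lemma exec_Load:
  assumes "ts 0 = (written (encode_tuple zs), int (pos zs n))" "ts i = (written [], 0)" "i \<noteq> 0"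
  shows "exec (Load i) ts (5 * length (encode_tuple zs) + 5)
    (ts(0 := (written (encode_tuple zs), int (pos zs (Suc n))), i := (written (letters (component zs n)), 0)))"
proof -
  let ?c = "written (encode_tuple zs)" and ?x = "component zs n"
  have 1: "exec (Copy 0 i (\<lambda>s. s = 0 \<or> s = 3)) ts (3 * length ?x + 1)
      (ts(0 := (?c, int (pos zs n) + int (length ?x)), i := (written (letters ?x), int (length ?x))))"
  proof (rule exec_cong[OF exec_Copy[where xs = "letters ?x" and ys = "[]" and c = ?c and h = "int (pos zs n)"]])
    fix k assume "k < length (letters ?x)"
    then have "n < length zs" "k < length ?x" by (auto simp: component_def split: if_splits)
    then show "?c (int (pos zs n) + int k) = letters ?x ! k \<and> \<not> (letters ?x ! k = 0 \<or> letters ?x ! k = 3)"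
      by (simp add: written_pos drop_component nth_append nth_letters)
  next
    show "?c (int (pos zs n) + int (length (letters ?x))) = 0 \<or> ?c (int (pos zs n) + int (length (letters ?x))) = 3"
      unfolding written_pos by (cases "n < length zs") (auto simp: drop_component nth_append)
  qed (use assms in auto)
  have 2: "exec (Move 0 Right) (ts(0 := (?c, int (pos zs n) + int (length ?x)), i := (written (letters ?x), int (length ?x)))) 1
     (ts(0 := (?c, int (pos zs (Suc n))), i := (written (letters ?x), int (length ?x))))"
    by (rule exec_cong[OF exec_Move]) (use assms(3) in \<open>auto simp: pos_Suc fun_eq_iff\<close>)
  have 3: "exec (Rewind i) (ts(0 := (?c, int (pos zs (Suc n))), i := (written (letters ?x), int (length ?x))))
     (2 * length ?x + 3) (ts(0 := (?c, int (pos zs (Suc n))), i := (written (letters ?x), 0)))"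
    by (rule exec_cong[OF exec_Rewind[where xs = "letters ?x" and k = "length ?x"]]) auto
  show ?thesis unfolding Load_def
    by (rule exec_weaken[OF exec_Seq[OF 1 exec_Seq[OF 2 3]]]) (use length_component[of zs n] in simp)
qed

definition letter :: "bool \<Rightarrow> nat" where
  "letter b = (if b then 2 else 1)"

text \<open>Beyond the third component, one letter is written per delimiter met on the input tape.
  \<open>Move 0 Stay\<close> acts as the empty command.\<close>

definition Out :: "bool \<Rightarrow> nat \<Rightarrow> prog" where
  "Out c r = Put 1 (\<lambda>_. letter ((r = 0) = c)) Right ;; Put 1 (\<lambda>_. letter ((r = 1) = c)) Right ;;
     Put 1 (\<lambda>_. letter ((r = 2) = c)) Right ;;
     While (\<lambda>v. v 0 \<noteq> 0)
       (Cond (\<lambda>v. v 0 = 3) (Put 1 (\<lambda>_. letter (\<not> c)) Right) (Move 0 Stay) ;; Move 0 Right)"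

lemma count_list_encode_tuple: "count_list (encode_tuple zs) 3 = length zs"
proof (induction zs)
  case (Cons z zs)
  then show ?case using count_list_0_iff[of "letters z" 3] by simp
qed simp

lemma exec_append_letter:
  assumes "ts i = (written (letters w), int (length w))"
  shows "exec (Put i (\<lambda>_. letter b) Right) ts 1 (ts(i := (written (letters (w @ [b])), int (length (w @ [b])))))"
proof -
  have "(written (letters w))(int (length w) := letter b) = written (letters (w @ [b]))"
    using written_snoc[of "letters w" "letter b"] by (simp add: letters_def letter_def)
  then show ?thesis using assms by (intro exec_cong[OF exec_Put_eq]) auto
qed

lemma exec_Out:
  assumes "ts 0 = (written (encode_tuple zs), int (pos zs 3))" "ts 1 = (written [], 0)"
  shows "\<exists>us. exec (Out c r) ts (4 * length (encode_tuple zs) + 4) us \<and>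
    fst (us 1) = written (letters ([(r = 0) = c, (r = 1) = c, (r = 2) = c] @ replicate (length zs - 3) (\<not> c)))"
proof -
  let ?c = "written (encode_tuple zs)" and ?R = "encode_tuple (drop 3 zs)"
  let ?w = "[(r = 0) = c, (r = 1) = c, (r = 2) = c]"
  define S where "S = (\<lambda>h w. ts(0 := (?c, h), 1 := (written (letters w), int (length w))))"
  have S [simp]: "S h w 0 = (?c, h)" "S h w 1 = (written (letters w), int (length w))" 
    "S h w (Suc 0) = (written (letters w), int (length w))" for h w
    by (auto simp: S_def)
  have put: "exec (Put 1 (\<lambda>_. letter b) Right) (S h w) 1 (S h (w @ [b]))" for h w b
    by (rule exec_cong[OF exec_append_letter]) (auto simp: S_def fun_eq_iff)
  have move: "exec (Move 0 m) (S h w) 1 (S (h + offset m) w)" for h w m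
    by (rule exec_cong[OF exec_Move]) (auto simp: S_def fun_eq_iff)
  have ts: "ts = S (int (pos zs 3)) []" using assms by (auto simp: S_def letters_def fun_eq_iff)
  define T where "T = (\<lambda>k. S (int (pos zs 3) + int k) (?w @ replicate (count_list (take k ?R) 3) (\<not> c)))"
  have "exec (While (\<lambda>v. v 0 \<noteq> 0)
       (Cond (\<lambda>v. v 0 = 3) (Put 1 (\<lambda>_. letter (\<not> c)) Right) (Move 0 Stay) ;; Move 0 Right))
     (T 0) (length ?R * Suc (Suc 1 + 1) + 1) (T (length ?R))"
  proof (rule exec_While_iterate, intro conjI)
    fix k assume k: "k < length ?R"
    have read: "reads (T k) 0 = ?R ! k" using k by (simp add: T_def written_pos)
    have "?R ! k \<in> {1, 2, 3}" using k set_encode_tuple nth_mem by blast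
    then show "reads (T k) 0 \<noteq> 0" using read by auto
    let ?v = "if ?R ! k = 3 then [\<not> c] else []"
    have w: "?w @ replicate (count_list (take (Suc k) ?R) 3) (\<not> c) =
        (?w @ replicate (count_list (take k ?R) 3) (\<not> c)) @ ?v"
      using k by (simp add: take_Suc_conv_app_nth replicate_append_same flip: replicate_Suc)
    have "exec (if reads (T k) 0 = 3 then Put 1 (\<lambda>_. letter (\<not> c)) Right else Move 0 Stay) (T k) 1
        (S (int (pos zs 3) + int k) ((?w @ replicate (count_list (take k ?R) 3) (\<not> c)) @ ?v))"
      unfolding read unfolding T_def
      using put[of "\<not> c" "int (pos zs 3) + int k" "?w @ replicate (count_list (take k ?R) 3) (\<not> c)"]
        move[of Stay "int (pos zs 3) + int k" "?w @ replicate (count_list (take k ?R) 3) (\<not> c)"] by simp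
    from exec_Cond[of "\<lambda>v. v 0 = 3", OF this]
    show "exec (Cond (\<lambda>v. v 0 = 3) (Put 1 (\<lambda>_. letter (\<not> c)) Right) (Move 0 Stay) ;; Move 0 Right)
        (T k) (Suc 1 + 1) (T (Suc k))"
      by (rule exec_cong[OF exec_Seq[OF _ move]]) (auto simp: T_def w[simplified] algebra_simps)
  qed (simp add: T_def written_pos)
  moreover have "T 0 = S (int (pos zs 3)) ?w" by (simp add: T_def)
  ultimately have loop: "exec (While (\<lambda>v. v 0 \<noteq> 0)
       (Cond (\<lambda>v. v 0 = 3) (Put 1 (\<lambda>_. letter (\<not> c)) Right) (Move 0 Stay) ;; Move 0 Right))
     (S (int (pos zs 3)) ?w) (length ?R * Suc (Suc 1 + 1) + 1) (T (length ?R))" by simp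
  have "exec (Out c r) ts (1 + (1 + (1 + (length ?R * Suc (Suc 1 + 1) + 1)))) (T (length ?R))"
    unfolding Out_def ts
    by (rule exec_Seq[OF put exec_Seq[OF put exec_Seq[OF put]]]) (use loop in simp)
  moreover have "length ?R \<le> length (encode_tuple zs)"
    using encode_tuple_append[of "take 3 zs" "drop 3 zs"] by simp
  ultimately have "exec (Out c r) ts (4 * length (encode_tuple zs) + 4) (T (length ?R))"
    by (elim exec_weaken) simp
  moreover have "fst (T (length ?R) 1) = written (letters (?w @ replicate (length zs - 3) (\<not> c)))"
    by (simp add: T_def count_list_encode_tuple)
  ultimately show ?thesis by blast
qed

section \<open>The upper bound for intersections and unions\<close>

lemma poly_nat_mono: "(x::nat) \<le> y \<Longrightarrow> poly p x \<le> poly p y"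
  by (induction p) (auto intro: add_mono mult_mono)

lemma P_SelE:
  assumes "A \<in> P_Sel"
  obtains f M and p :: "nat poly" where "valid_tm M"
    and "\<And>x y. \<exists>t\<le>poly p (length x + length y + 2). halts_with ((step M ^^ t) (init_config M [x, y])) (f [x, y])"
    and "\<And>x y. f [x, y] \<in> {x, y}" and "\<And>x y. x \<in> A \<or> y \<in> A \<Longrightarrow> f [x, y] \<in> A"
proof -
  from assms obtain f where f: "poly_time_on {zs. length zs = 2} f"
    "\<And>x y. f [x, y] \<in> {x, y} \<and> (x \<in> A \<or> y \<in> A \<longrightarrow> f [x, y] \<in> A)"
    unfolding P_Sel_def by blast
  from f(1) obtain M and p :: "nat poly" where M: "valid_tm M"
    "\<forall>zs\<in>{zs. length zs = 2}. \<exists>t\<le>poly p (length (encode_tuple zs)).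
       halts_with ((step M ^^ t) (init_config M zs)) (f zs)"
    unfolding poly_time_on_def by blast
  have "\<exists>t\<le>poly p (length x + length y + 2). halts_with ((step M ^^ t) (init_config M [x, y])) (f [x, y])" for x y
    using bspec[OF M(2), of "[x, y]"] by simp
  with that[OF M(1)] f(2) show thesis by blast
qed

text \<open>For \<open>c = False\<close> this is the property of a selector. For
  \<open>c = True\<close> it is the contrapositive: if the loser were in \<open>A\<close>, so would
  be the winner.\<close>

lemma choice_selects:
  assumes "\<And>x y. f [x, y] \<in> {x, y}" "\<And>x y. x \<in> A \<or> y \<in> A \<Longrightarrow> f [x, y] \<in> A"
    and "choice c (f [W i, W j] = W i) i j = (a, b)" "(W b \<in> A) = (\<not> c)"
  shows "(W a \<in> A) = (\<not> c)"
  using assms(1,2)[of "W i" "W j"] assms(3,4) by (cases c) (auto simp: choice_def split: if_splits)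

lemma choice_cases: "choice c won i j = (a, b) \<Longrightarrow> (a, b) = (i, j) \<or> (a, b) = (j, i)"
  by (auto simp: choice_def split: if_splits)

text \<open>
  For \<open>c = False\<close> this concerns intersections and for \<open>c = True\<close> unions. Among three words, the
  program finds one that beats another one (loses to another one, if \<open>c\<close>) for either selector, and
  predicts \<open>c\<close> for it and the opposite for all other words.
\<close>

theorem P_mc_3_if_combination:
  assumes "A \<in> P_Sel" "B \<in> P_Sel"
    and L: "\<And>z. (z \<in> L) = (\<not> c) \<longleftrightarrow> (z \<in> A) = (\<not> c) \<and> (z \<in> B) = (\<not> c)"
  shows "L \<in> P_mc 3"
proof -
  from assms(1) obtain f M and p :: "nat poly" where M: "valid_tm M"
    and haltM: "\<And>x y. \<exists>t\<le>poly p (length x + length y + 2). halts_with ((step M ^^ t) (init_config M [x, y])) (f [x, y])"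
    and f: "\<And>x y. f [x, y] \<in> {x, y}" "\<And>x y. x \<in> A \<or> y \<in> A \<Longrightarrow> f [x, y] \<in> A"
    by (rule P_SelE) blast
  from assms(2) obtain g N and q :: "nat poly" where N: "valid_tm N"
    and haltN: "\<And>x y. \<exists>t\<le>poly q (length x + length y + 2). halts_with ((step N ^^ t) (init_config N [x, y])) (g [x, y])"
    and g: "\<And>x y. g [x, y] \<in> {x, y}" "\<And>x y. x \<in> B \<or> y \<in> B \<Longrightarrow> g [x, y] \<in> B"
    by (rule P_SelE) blast
  \<comment> \<open>Tapes 0 and 1 are input and output, so word number \<open>i - 2\<close> lies on
    tape \<open>i\<close>. Missing components count as empty words: the program must halt on short
    tuples as well.\<close>
  define W where "W = (\<lambda>zs i. component zs (i - 2))"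
  define pick where "pick = (\<lambda>h zs i j. choice c (h [W zs i, W zs j] = W zs i) i j)"
  \<comment> \<open>The second round pits \<open>b\<close>, not \<open>a\<close>, against the third
    word. Its candidate \<open>a'\<close> therefore differs from \<open>a\<close>, and each of the
    two has an opponent in a round of the first selector.\<close>
  define res where "res = (\<lambda>zs. case pick f zs 2 3 of (a, b) \<Rightarrow> case pick f zs b 4 of (a', b') \<Rightarrow> fst (pick g zs a a') - 2)"
  define F where "F = (\<lambda>zs. [(res zs = 0) = c, (res zs = 1) = c, (res zs = 2) = c] @ replicate (length zs - 3) (\<not> c))"

  let ?k = "num_tapes M" and ?n = "num_tapes N"
  \<comment> \<open>Tapes 0 to 4 are input, output and the three words. Every round takes fresh
    tapes, those of the called machine and one shadow tape.\<close>
  define d1 where "d1 = (5 :: nat)"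
  define d2 where "d2 = 6 + ?k"
  define d3 where "d3 = 7 + 2 * ?k"
  define K where "K = 8 + 2 * ?k + ?n"
  define G where "G = max (num_symbols M) (num_symbols N)"
  define C3 where "C3 = (\<lambda>(r :: nat, s :: nat). Out c (r - 2))"
  define C2 where "C2 = (\<lambda>a (a', b' :: nat). Round c N d3 a a' C3)"
  define C1 where "C1 = (\<lambda>(a, b). Round c M d2 b 4 (C2 a))"
  define P where "P = Load 2 ;; Load 3 ;; Load 4 ;; Round c M d1 2 3 C1"
  \<comment> \<open>\<open>[:2, 2:]\<close> bounds the length of an encoded pair of components in
    terms of the whole input. There are two rounds with \<open>M\<close> and one with
    \<open>N\<close>, each charged ten times the running time of its call.\<close>
  define Q where "Q = [:300, 200:] + smult 20 (pcompose p [:2, 2:]) + smult 10 (pcompose q [:2, 2:])"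

  have G: "4 \<le> G" "num_symbols M \<le> G" "num_symbols N \<le> G" using M by (auto simp: G_def valid_tm_def)
  have K: "d1 + ?k < K" "d2 + ?k < K" "d3 + ?n < K" "5 \<le> K" by (auto simp: K_def d1_def d2_def d3_def)
  have wf_Out: "wf_prog K G (Out c r)" for r
    using G K by (auto simp: Out_def letter_def)
  have wf2: "wf_prog K G (C2 a x)" if "a < 5" "fst x < 5" for a x
    using that K G N wf_Out by (cases x) (auto simp: C2_def C3_def Round_def choice_def intro!: wf_Duel)
  have wf1: "wf_prog K G (C1 x)" if "fst x < 5" "snd x < 5" for x
    using that K G M wf2 by (cases x) (auto simp: C1_def Round_def choice_def intro!: wf_Duel)
  have wf: "wf_prog K G P"
    using K G M wf1 by (auto simp: P_def Load_def Round_def choice_def intro!: wf_Duel)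

  have "\<exists>us. exec P (input_store zs) (poly Q (length (encode_tuple zs))) us \<and> fst (us 1) = written (letters (F zs))" for zs
  proof -
    let ?e = "length (encode_tuple zs)" and ?c = "written (encode_tuple zs)"
    let ?R = "\<lambda>us. fst (us 1) = written (letters (F zs))"
    let ?T = "\<lambda>r. poly r (2 * ?e + 2)"
    have lenW: "length (W zs i) \<le> ?e" for i unfolding W_def by (rule length_component)
    have halt_mono: "\<exists>t\<le>?T r. halts_with ((step X ^^ t) (init_config X [W zs i, W zs j])) (h [W zs i, W zs j])"
      if "\<And>x y. \<exists>t\<le>poly r (length x + length y + 2). halts_with ((step X ^^ t) (init_config X [x, y])) (h [x, y])"
      for X r h i j
    proof -
      have "poly r (length (W zs i) + length (W zs j) + 2) \<le> ?T r"
        by (rule poly_nat_mono) (use lenW[of i] lenW[of j] in linarith)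
      then show ?thesis using that order_trans by blast
    qed
    define good where "good = (\<lambda>d (ts :: store). ts 0 = (?c, int (pos zs 3)) \<and> ts 1 = (written [], 0) \<and>
      (\<forall>i\<in>{2, 3, 4}. ts i = (written (letters (W zs i)), 0)) \<and> (\<forall>l\<ge>d. ts l = (written [], 0)))"
    have good_frame: "good d' us" if "good d ts" "\<And>l. l < d \<or> d + k < l \<Longrightarrow> us l = ts l" "5 \<le> d" "d + k < d'" for d d' k ts us
      using that unfolding good_def by auto
    have round: "\<exists>us. exec (Round c X d i j C) ts (24 * ?e + 10 * T + 60 + b) us \<and> ?R us"
      if X: "valid_tm X"
        "\<And>i j. \<exists>t\<le>T. halts_with ((step X ^^ t) (init_config X [W zs i, W zs j])) (h [W zs i, W zs j])"
        and ts: "good d ts" "5 \<le> d" "i \<in> {2, 3, 4}" "j \<in> {2, 3, 4}" "i \<noteq> j"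
        and C: "\<And>us. good (d + num_tapes X + 1) us \<Longrightarrow> \<exists>vs. exec (C (pick h zs i j)) us b vs \<and> ?R vs"
      for X T h d ts i j C b
    proof -
      obtain t where t: "t \<le> T" "halts_with ((step X ^^ t) (init_config X [W zs i, W zs j])) (h [W zs i, W zs j])"
        using X(2) by blast
      have "\<exists>us. exec (Round c X d i j C) ts (12 * (length (W zs i) + length (W zs j)) + 10 * t + 60 + b) us \<and> ?R us"
      proof (rule exec_Round[OF X(1) t(2)])
        fix us assume frame: "\<And>l. l < d \<or> d + num_tapes X < l \<Longrightarrow> us l = ts l"
        have "good (d + num_tapes X + 1) us" by (rule good_frame[OF ts(1) frame ts(2)]) auto
        from C[OF this] show "\<exists>vs. exec (C (choice c (h [W zs i, W zs j] = W zs i) i j)) us b vs \<and> ?R vs"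
          by (simp add: pick_def)
      qed (use ts in \<open>auto simp: good_def\<close>)
      then obtain us where us: "exec (Round c X d i j C) ts (12 * (length (W zs i) + length (W zs j)) + 10 * t + 60 + b) us" "?R us"
        by blast
      have "12 * (length (W zs i) + length (W zs j)) + 10 * t + 60 + b \<le> 24 * ?e + 10 * T + 60 + b"
      proof -
        have "length (W zs i) + length (W zs j) \<le> 2 * ?e" using lenW[of i] lenW[of j] by simp
        then show ?thesis using t(1) by simp
      qed
      with us(1) have "exec (Round c X d i j C) ts (24 * ?e + 10 * T + 60 + b) us"
        by (rule exec_weaken)
      with us(2) show ?thesis by blast
    qed
    note roundM = round[OF M halt_mono[OF haltM]] and roundN = round[OF N halt_mono[OF haltN]]
    obtain a b where ab: "pick f zs 2 3 = (a, b)" by fastforce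
    obtain a' b' where ab': "pick f zs b 4 = (a', b')" by fastforce
    obtain r s where rs: "pick g zs a a' = (r, s)" by fastforce
    have idx: "a \<in> {2, 3}" "b \<in> {2, 3}" "a \<noteq> b" "a' = b \<or> a' = 4"
      using choice_cases[OF ab[unfolded pick_def]] choice_cases[OF ab'[unfolded pick_def]] by auto
    have res: "res zs = r - 2" by (simp add: res_def ab ab' rs)
    have 3: "\<exists>us. exec (C3 (pick g zs a a')) ts (4 * ?e + 4) us \<and> ?R us" if "good d ts" for d ts
      using exec_Out[of ts zs c "r - 2"] that by (simp add: C3_def rs F_def res good_def)
    have 2: "\<exists>us. exec (C2 a (pick f zs b 4)) ts (24 * ?e + 10 * ?T q + 60 + (4 * ?e + 4)) us \<and> ?R us"
      if "good d3 ts" for ts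
      unfolding ab' C2_def prod.case
      by (rule roundN[OF that]) (use idx 3 in \<open>auto simp: d3_def\<close>)
    have 1: "\<exists>us. exec (C1 (pick f zs 2 3)) ts (24 * ?e + 10 * ?T p + 60 + (24 * ?e + 10 * ?T q + 60 + (4 * ?e + 4))) us \<and> ?R us"
      if "good d2 ts" for ts
      unfolding ab C1_def prod.case
    proof (rule roundM[OF that])
      fix us assume "good (d2 + ?k + 1) us"
      then have "good d3 us" by (simp add: d2_def d3_def algebra_simps)
      then show "\<exists>vs. exec (C2 a (pick f zs b 4)) us (24 * ?e + 10 * ?T q + 60 + (4 * ?e + 4)) vs \<and> ?R vs" by (rule 2)
    qed (use idx in \<open>auto simp: d2_def\<close>)
    have 0: "\<exists>us. exec (Round c M d1 2 3 C1) ts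
        (24 * ?e + 10 * ?T p + 60 + (24 * ?e + 10 * ?T p + 60 + (24 * ?e + 10 * ?T q + 60 + (4 * ?e + 4)))) us \<and> ?R us"
      if "good d1 ts" for ts
    proof (rule roundM[OF that])
      fix us assume "good (d1 + ?k + 1) us"
      then have "good d2 us" by (simp add: d1_def d2_def algebra_simps)
      then show "\<exists>vs. exec (C1 (pick f zs 2 3)) us (24 * ?e + 10 * ?T p + 60 + (24 * ?e + 10 * ?T q + 60 + (4 * ?e + 4))) vs \<and> ?R vs"
        by (rule 1)
    qed (auto simp: d1_def)
    define t1 where "t1 = (input_store zs)(0 := (?c, int (pos zs (Suc 0))), 2 := (written (letters (component zs 0)), 0))"
    define t2 where "t2 = t1(0 := (?c, int (pos zs (Suc 1))), 3 := (written (letters (component zs 1)), 0))"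
    define t3 where "t3 = t2(0 := (?c, int (pos zs (Suc 2))), 4 := (written (letters (component zs 2)), 0))"
    have L1: "exec (Load 2) (input_store zs) (5 * ?e + 5) t1"
      unfolding t1_def by (rule exec_Load) (auto simp: input_store_def pos_def)
    have L2: "exec (Load 3) t1 (5 * ?e + 5) t2"
      unfolding t2_def by (rule exec_Load) (auto simp: t1_def input_store_def)
    have L3: "exec (Load 4) t2 (5 * ?e + 5) t3"
      unfolding t3_def by (rule exec_Load) (auto simp: t1_def t2_def input_store_def numeral_2_eq_2)
    have "good d1 t3"
      by (auto simp: good_def d1_def t1_def t2_def t3_def input_store_def W_def numeral_3_eq_3)
    from 0[OF this] obtain us where us: "exec (Round c M d1 2 3 C1) t3
        (24 * ?e + 10 * ?T p + 60 + (24 * ?e + 10 * ?T p + 60 + (24 * ?e + 10 * ?T q + 60 + (4 * ?e + 4)))) us" "?R us"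
      by blast
    have "poly [:2, 2:] ?e = 2 * ?e + 2" by simp
    then have Q: "poly Q ?e = 200 * ?e + 300 + 20 * ?T p + 10 * ?T q"
      unfolding Q_def poly_add poly_smult poly_pcompose by (simp only:) simp
    have "exec P (input_store zs) (poly Q ?e) us"
      unfolding P_def
      by (rule exec_weaken[OF exec_Seq[OF L1 exec_Seq[OF L2 exec_Seq[OF L3 us(1)]]]])
         (simp add: Q)
    with us(2) show ?thesis by blast
  qed
  then have "poly_time_on UNIV F"
    using K G by (intro poly_time_onI[OF _ _ wf]) auto
  moreover have "length (F zs) = length zs" "map (\<lambda>z. z \<in> L) zs \<noteq> F zs" if "3 \<le> length zs" for zs
  proof -
    show "length (F zs) = length zs" using that by (simp add: F_def)
    obtain a b where ab: "pick f zs 2 3 = (a, b)" by fastforce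
    obtain a' b' where ab': "pick f zs b 4 = (a', b')" by fastforce
    obtain r s where rs: "pick g zs a a' = (r, s)" by fastforce
    have res: "res zs = r - 2" by (simp add: res_def ab ab' rs)
    have idx: "(a, b) = (2, 3) \<or> (a, b) = (3, 2)" "(a', b') = (b, 4) \<or> (a', b') = (4, b)" "(r, s) = (a, a') \<or> (r, s) = (a', a)"
      using choice_cases[OF ab[unfolded pick_def]] choice_cases[OF ab'[unfolded pick_def]]
        choice_cases[OF rs[unfolded pick_def]] by auto
    have selA: "(W zs b \<in> A) = (\<not> c) \<Longrightarrow> (W zs a \<in> A) = (\<not> c)" "(W zs b' \<in> A) = (\<not> c) \<Longrightarrow> (W zs a' \<in> A) = (\<not> c)"
      using choice_selects[where W = "W zs" and f = f, OF f ab[unfolded pick_def]] choice_selects[where W = "W zs" and f = f, OF f ab'[unfolded pick_def]]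
      by blast+
    have selB: "(W zs s \<in> B) = (\<not> c) \<Longrightarrow> (W zs r \<in> B) = (\<not> c)"
      using choice_selects[where W = "W zs" and f = g, OF g rs[unfolded pick_def]] by blast
    show "map (\<lambda>z. z \<in> L) zs \<noteq> F zs"
    proof
      assume eq: "map (\<lambda>z. z \<in> L) zs = F zs"
      have val: "(W zs i \<in> L) = ((r = i) = c)" if "i \<in> {2, 3, 4}" for i
      proof -
        have "i - 2 < length zs" using that \<open>3 \<le> length zs\<close> by auto
        then have "(W zs i \<in> L) = F zs ! (i - 2)" unfolding eq[symmetric] by (simp add: W_def component_def)
        also have "\<dots> = ((r = i) = c)"
          using that idx unfolding F_def res by (auto simp: nth_Cons')
        finally show ?thesis .
      qed
      have other: "(W zs i \<in> A) = (\<not> c) \<and> (W zs i \<in> B) = (\<not> c)" if "i \<in> {2, 3, 4}" "i \<noteq> r" for i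
        using val[OF that(1)] that(2) L[of "W zs i"] by auto
      \<comment> \<open>The candidate \<open>r\<close> is \<open>a\<close> or \<open>a'\<close>, so
        its opponent for \<open>A\<close> is \<open>b\<close> or \<open>b'\<close>, and
        \<open>s\<close> is its opponent for \<open>B\<close>. These differ from \<open>r\<close>
        and hence lie on the predicted side, which forces \<open>r\<close> onto that side as well,
        against the prediction.\<close>
      have mem: "{a, b, a', b', r, s} \<subseteq> {2, 3, 4}" "a \<noteq> b" "a' \<noteq> b'" "r \<noteq> s" "r = a \<or> r = a'" using idx by auto
      then have "(W zs r \<in> B) = (\<not> c)" using selB other[of s] by auto
      moreover have "(W zs r \<in> A) = (\<not> c)"
        using mem selA other[of b] other[of b'] by auto
      ultimately have "(W zs r \<in> L) = (\<not> c)" using L by blast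
      then show False using val[of r] mem by auto
    qed
  qed
  ultimately show ?thesis unfolding P_mc_def by blast
qed

lemma class_and_P_mc_3: "class_and P_Sel P_Sel \<subseteq> P_mc 3"
  using P_mc_3_if_combination[where c = False] by (auto simp: class_and_def)

lemma class_or_P_mc_3: "class_or P_Sel P_Sel \<subseteq> P_mc 3"
  using P_mc_3_if_combination[where c = True] by (auto simp: class_or_def)

theorem theorem4p7:
  shows "(class_and P_Sel P_Sel \<subseteq> P_mc 3 \<and> \<not> class_and P_Sel P_Sel \<subseteq> P_mc 2) \<and>
         (class_or P_Sel P_Sel \<subseteq> P_mc 3 \<and> \<not> class_or P_Sel P_Sel \<subseteq> P_mc 2) \<and>
         (\<not> class_xor P_Sel P_Sel \<subseteq> P_mc 3 \<and> \<not> class_nxor P_Sel P_Sel \<subseteq> P_mc 3)"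
  using class_and_P_mc_3 class_and_not_P_mc_2 class_or_P_mc_3 class_or_not_P_mc_2
    class_xor_not_P_mc_3 class_nxor_not_P_mc_3 by blast

end
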